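(* Assume (A3), (A4). Suppose either $p\in(0,2)$, $q\in(0,1]$ and $q+1<p$, or $p=2$, $q\in(0,1)$ and $\beta\ge q(1-q)$. Let $x$ be a bounded trajectory solution of (MTRIGS) with initial data $(x_0,v_0)$. Then for each $i$ the limit $f_i^\infty:=\lim_{t\to\infty}f_i(x(t))\in\mathbb R$ exists, and $x(t)$ converges weakly, as $t\to+\infty$, to a weak Pareto optimal point of $\min_{x\in\mathcal H}F(x)$ which belongs to $\bigcap_{i=1}^m\{x\in\mathcal H: f_i(x)\le f_i^\infty\}$.
   Context: $\mathcal H$ real Hilbert space; $f_1,\dots,f_m:\mathcal H\to\mathbb R$ convex, continuously differentiable with Lipschitz continuous gradients; $F=(f_1,\dots,f_m)^\top$. Weak Pareto optimal: no $x$ with $f_i(x)<f_i(x^* )$ for all $i$; $\mathcal P_w$ the set of such points. $\mathcal L(F,b):=\{x:f_i(x)\le b_i\ \forall i\}$, $\mathcal{LP}_w(F,b):=\mathcal L(F,b)\cap\mathcal P_w$. Parameters $t_0>0$, $\alpha,\beta>0$, $q\in(0,1]$, $p\in(0,2]$, initial data $x_0,v_0\in\mathcal H$; $C(x):=\operatorname{conv}\{\nabla f_i(x)\}$. A trajectory solution of (MTRIGS) is $x:[t_0,\infty)\to\mathcal H$, continuously differentiable, with $\dot x$ absolutely continuous on each $[t_0,T]$ and a.e. derivative $\ddot x$ (Bochner measurable, $\dot x(t)=\dot x(t_0)+\int_{t_0}^t\ddot x$), satisfying $\frac{\alpha}{t^q}\dot x(t)+\operatorname{proj}_{C(x(t))+\frac{\beta}{t^p}x(t)+\ddot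 x(t)}(0)=0$ for a.e. $t\ge t_0$, $x(t_0)=x_0$, $\dot x(t_0)=v_0$. (A3): with $a_i:=\frac{\beta}{2t_0^p}\|x_0\|^2+\frac12\|v_0\|^2$, for every $x\in\mathcal L(F,F(x_0)+a)$, $\mathcal{LP}_w(F,F(x))\ne\emptyset$, and $R:=\sup_{F^*\in F(\mathcal{LP}_w(F,F(x_0)+a))}\inf_{z\in F^{-1}(\{F^*\})}\|z\|<\infty$. (A4): $S(w):=\operatorname{argmin}_z\max_i(f_i(z)-w_i)\neq\emptyset$ for all $w\in\mathbb R^m$ and $w\mapsto\operatorname{proj}_{S(w)}(0)$ is continuous. *)

theory Defs
  imports "HOL-Analysis.Analysis"
begin

text \<open>Projection of a point onto a set: the (unique, for closed convex nonempty
  sets in a Hilbert space) nearest point.\<close>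
definition proj :: "'a::real_inner set \<Rightarrow> 'a \<Rightarrow> 'a" where
  "proj S z = (THE y. y \<in> S \<and> (\<forall>w\<in>S. dist z y \<le> dist z w))"

definition Fvec :: "('m::finite \<Rightarrow> 'a \<Rightarrow> real) \<Rightarrow> 'a \<Rightarrow> real^'m" where
  "Fvec f x = (\<chi> i. f i x)"

definition wpareto :: "('m::finite \<Rightarrow> 'a \<Rightarrow> real) \<Rightarrow> 'a set" where
  "wpareto f = {x. \<not> (\<exists>y. \<forall>i. f i y < f i x)}"

definition lev :: "('m::finite \<Rightarrow> 'a \<Rightarrow> real) \<Rightarrow> real^'m \<Rightarrow> 'a set" where
  "lev f b = {x. \<forall>i. f i x \<le> b $ i}"

definition levP :: "('m::finite \<Rightarrow> 'a \<Rightarrow> real) \<Rightarrow> real^'m \<Rightarrow> 'a set" where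
  "levP f b = lev f b \<inter> wpareto f"

definition abs_cont_on :: "real set \<Rightarrow> (real \<Rightarrow> 'a::real_normed_vector) \<Rightarrow> bool" where
  "abs_cont_on I g \<longleftrightarrow> (\<forall>\<epsilon>>0. \<exists>\<delta>>0. \<forall>n (a::nat \<Rightarrow> real) b.
      (\<forall>k<n. a k \<le> b k \<and> {a k..b k} \<subseteq> I) \<and>
      (\<forall>k<n. \<forall>l<n. k \<noteq> l \<longrightarrow> b k \<le> a l \<or> b l \<le> a k) \<and>
      (\<Sum>k<n. b k - a k) < \<delta> \<longrightarrow>
      (\<Sum>k<n. norm (g (b k) - g (a k))) < \<epsilon>)"

definition mtrigs_solution ::
  "('m::finite \<Rightarrow> 'a::{real_inner,complete_space} \<Rightarrow> 'a) \<Rightarrow> real \<Rightarrow> real \<Rightarrow> real \<Rightarrow> real \<Rightarrow> real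
   \<Rightarrow> 'a \<Rightarrow> 'a \<Rightarrow> (real \<Rightarrow> 'a) \<Rightarrow> bool" where
  "mtrigs_solution df t0 \<alpha> \<beta> q p x0 v0 x \<longleftrightarrow>
    (\<exists>xd xdd.
      (\<forall>t\<ge>t0. (x has_vector_derivative xd t) (at t within {t0..})) \<and>
      continuous_on {t0..} xd \<and>
      (\<forall>T\<ge>t0. abs_cont_on {t0..T} xd) \<and>
      xdd \<in> borel_measurable (restrict_space lebesgue {t0..}) \<and>
      (AE t in lebesgue. t \<ge> t0 \<longrightarrow> (xd has_vector_derivative xdd t) (at t)) \<and>
      (\<forall>t\<ge>t0. (xdd has_integral (xd t - xd t0)) {t0..t}) \<and>
      (AE t in lebesgue. t \<ge> t0 \<longrightarrow>
         (\<alpha> / t powr q) *\<^sub>R xd t +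
         proj ((\<lambda>c. c + (\<beta> / t powr p) *\<^sub>R x t + xdd t) ` (convex hull (range (\<lambda>i. df i (x t))))) 0
         = 0) \<and>
      x t0 = x0 \<and> xd t0 = v0)"

definition A3 :: "('m::finite \<Rightarrow> 'a::real_inner \<Rightarrow> real) \<Rightarrow> real \<Rightarrow> real \<Rightarrow> real \<Rightarrow> 'a \<Rightarrow> 'a \<Rightarrow> bool" where
  "A3 f t0 \<beta> p x0 v0 \<longleftrightarrow>
    (let a = (\<chi> i. \<beta> / (2 * t0 powr p) * (norm x0)\<^sup>2 + 1/2 * (norm v0)\<^sup>2) in
      (\<forall>x \<in> lev f (Fvec f x0 + a). levP f (Fvec f x) \<noteq> {}) \<and>
      (\<exists>R. \<forall>Fs \<in> Fvec f ` levP f (Fvec f x0 + a).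
          (INF z\<in>{z. Fvec f z = Fs}. norm z) \<le> R))"

definition Sset :: "('m::finite \<Rightarrow> 'a \<Rightarrow> real) \<Rightarrow> real^'m \<Rightarrow> 'a set" where
  "Sset f w = {z. \<forall>y. Max (range (\<lambda>i. f i z - w $ i)) \<le> Max (range (\<lambda>i. f i y - w $ i))}"

definition A4 :: "('m::finite \<Rightarrow> 'a::real_inner \<Rightarrow> real) \<Rightarrow> bool" where
  "A4 f \<longleftrightarrow> (\<forall>w. Sset f w \<noteq> {}) \<and> continuous_on UNIV (\<lambda>w. proj (Sset f w) 0)"

end

theory Submission
  imports Defs
begin

text \<open>Along a bounded trajectory the energies
  \<open>W\<^sub>i = f\<^sub>i(x) + |x'|\<^sup>2/2 + \<beta>|x|\<^sup>2/(2t\<^sup>p)\<close> satisfy \<open>W\<^sub>i' \<le> - \<alpha>|x'|\<^sup>2/t\<^sup>q\<close>; hence they converge, and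
  with \<open>D\<close> the dissipated energy, \<open>W\<^sub>i(t) - W\<^sub>i(\<infinity>) \<ge> R(t) = D(\<infinity>) - D(t)\<close> for all \<open>i\<close> at once.
  For \<open>z\<close> with \<open>f\<^sub>i(z) + \<eta> \<le> W\<^sub>i(\<infinity>)\<close> for all \<open>i\<close>, the function \<open>h = |x - z|\<^sup>2/2\<close> then satisfies
  \<open>h'' + \<alpha>h'/t\<^sup>q + R + \<eta> \<le> 3|x'|\<^sup>2/2 + \<beta>|z|\<^sup>2/(2t\<^sup>p)\<close> almost everywhere.

  Differentiating \<open>t\<^sup>2\<^sup>q (R + 2q h'/t)\<close> and bounding the boundary term by \<open>|x'|\<close> gives, for
  \<open>I(t) = \<integral> s\<^sup>q |x'|\<^sup>2 ds\<close>, an inequality \<open>I \<le> A + C sqrt (t I')\<close>, which forces \<open>I\<close> to be bounded. Therefore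
  \<open>x' \<rightarrow> 0\<close> and \<open>f\<^sub>i(x) \<rightarrow> W\<^sub>i(\<infinity>)\<close>. Moreover \<open>h + t\<^sup>q h'/\<alpha> + \<eta> t\<^sup>q\<^sup>+\<^sup>1/(\<alpha>(q+1))\<close> is
  nonincreasing up to a convergent term. For \<open>\<eta> = 0\<close> this makes \<open>h\<close> converge, and Opial's argument gives
  the weak limit; for \<open>\<eta> > 0\<close> it would make \<open>h\<close> negative, so no point improves strictly on the limit
  values and the weak limit is weakly Pareto optimal.\<close>

section \<open>Absolutely continuous functions\<close>

lemma abs_cont_onE:
  assumes "abs_cont_on I g" and "\<epsilon> > 0"
  obtains \<delta> where "\<delta> > 0" and "\<And>n (a::nat \<Rightarrow> real) b.
      (\<forall>k<n. a k \<le> b k \<and> {a k..b k} \<subseteq> I) \<Longrightarrow>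
      (\<forall>k<n. \<forall>l<n. k \<noteq> l \<longrightarrow> b k \<le> a l \<or> b l \<le> a k) \<Longrightarrow>
      (\<Sum>k<n. b k - a k) < \<delta> \<Longrightarrow> (\<Sum>k<n. norm (g (b k) - g (a k))) < \<epsilon>"
proof -
  obtain \<delta> where \<delta>: "\<delta> > 0 \<and> (\<forall>n (a::nat \<Rightarrow> real) b.
      (\<forall>k<n. a k \<le> b k \<and> {a k..b k} \<subseteq> I) \<and>
      (\<forall>k<n. \<forall>l<n. k \<noteq> l \<longrightarrow> b k \<le> a l \<or> b l \<le> a k) \<and>
      (\<Sum>k<n. b k - a k) < \<delta> \<longrightarrow> (\<Sum>k<n. norm (g (b k) - g (a k))) < \<epsilon>)"
    using assms(1)[unfolded abs_cont_on_def, THEN spec, THEN mp, OF assms(2)] by (rule exE)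
  show ?thesis
    by (rule that[OF conjunct1[OF \<delta>]])
      (rule conjunct2[OF \<delta>, THEN spec, THEN spec, THEN spec, THEN mp], intro conjI)
qed

lemma abs_cont_on_subset:
  assumes "abs_cont_on I g" and "J \<subseteq> I"
  shows "abs_cont_on J g"
  unfolding abs_cont_on_def
proof (intro allI impI)
  fix \<epsilon> :: real assume "\<epsilon> > 0"
  show "\<exists>\<delta>>0. \<forall>n (a::nat \<Rightarrow> real) b.
      (\<forall>k<n. a k \<le> b k \<and> {a k..b k} \<subseteq> J) \<and>
      (\<forall>k<n. \<forall>l<n. k \<noteq> l \<longrightarrow> b k \<le> a l \<or> b l \<le> a k) \<and>
      (\<Sum>k<n. b k - a k) < \<delta> \<longrightarrow> (\<Sum>k<n. norm (g (b k) - g (a k))) < \<epsilon>"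
  proof (rule abs_cont_onE[OF assms(1) \<open>\<epsilon> > 0\<close>], intro exI conjI allI impI; (elim conjE)?)
    fix \<delta> and n and a b :: "nat \<Rightarrow> real"
    assume \<delta>: "\<And>n (a::nat \<Rightarrow> real) b. (\<forall>k<n. a k \<le> b k \<and> {a k..b k} \<subseteq> I) \<Longrightarrow>
        (\<forall>k<n. \<forall>l<n. k \<noteq> l \<longrightarrow> b k \<le> a l \<or> b l \<le> a k) \<Longrightarrow>
        (\<Sum>k<n. b k - a k) < \<delta> \<Longrightarrow> (\<Sum>k<n. norm (g (b k) - g (a k))) < \<epsilon>"
      and J: "\<forall>k<n. a k \<le> b k \<and> {a k..b k} \<subseteq> J"
      and d: "\<forall>k<n. \<forall>l<n. k \<noteq> l \<longrightarrow> b k \<le> a l \<or> b l \<le> a k" "(\<Sum>k<n. b k - a k) < \<delta>"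
    have "\<forall>k<n. a k \<le> b k \<and> {a k..b k} \<subseteq> I" using J assms(2) by (meson order_trans)
    then show "(\<Sum>k<n. norm (g (b k) - g (a k))) < \<epsilon>" using d by (rule \<delta>)
  qed
qed

text \<open>Differentiability almost everywhere becomes a global bound through a tagged division of
  \<open>{a..b}\<close>. Cells with a good tag gain at most \<open>e\<close> times their length;
  cells tagged in the exceptional set \<open>N\<close> have small total length, so absolute
  continuity keeps their joint gain below \<open>e\<close>.\<close>

lemma abs_cont_on_antimono:
  fixes \<phi> :: "real \<Rightarrow> real"
  assumes "a \<le> b" and ac: "abs_cont_on {a..b} \<phi>"
    and ae: "AE t in lebesgue. t \<in> {a..b} \<longrightarrow>
      (\<exists>D\<le>0. (\<phi> has_real_derivative D) (at t within {a..b}))"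
  shows "\<phi> b \<le> \<phi> a"
proof -
  define N where "N = {t \<in> {a..b}. \<not> (\<exists>D\<le>0. (\<phi> has_real_derivative D) (at t within {a..b}))}"
  have "negligible N"
  proof -
    obtain M where M: "M \<in> null_sets lebesgue"
      "{t \<in> space lebesgue. \<not> (t \<in> {a..b} \<longrightarrow>
        (\<exists>D\<le>0. (\<phi> has_real_derivative D) (at t within {a..b})))} \<subseteq> M"
      using ae unfolding eventually_ae_filter by blast
    have "N \<subseteq> M" using M(2) by (auto simp: N_def)
    then show ?thesis
      using M(1) negligible_iff_null_sets negligible_subset by blast
  qed
  \<comment> \<open>The gauge integral of the indicator of \<open>N\<close> is \<open>0\<close>;
    unfolding that integral below yields a gauge for which the cells tagged in \<open>N\<close> have
    total length less than \<open>\<delta>\<close>.\<close>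
  then have N0: "(indicator N has_integral (0::real)) (cbox a b)"
    by (simp add: negligible_def)
  have step: "\<phi> b - \<phi> a \<le> e * (b - a) + e" if "e > 0" for e
  proof -
    obtain \<delta> where "\<delta> > 0" and \<delta>: "\<And>n (u::nat \<Rightarrow> real) v.
        (\<forall>k<n. u k \<le> v k \<and> {u k..v k} \<subseteq> {a..b}) \<Longrightarrow>
        (\<forall>k<n. \<forall>l<n. k \<noteq> l \<longrightarrow> v k \<le> u l \<or> v l \<le> u k) \<Longrightarrow>
        (\<Sum>k<n. v k - u k) < \<delta> \<Longrightarrow> (\<Sum>k<n. norm (\<phi> (v k) - \<phi> (u k))) < e"
      by (rule abs_cont_onE[OF ac \<open>e > 0\<close>], rule that)
    obtain \<gamma>1 where \<gamma>1: "gauge \<gamma>1" "\<And>p. p tagged_division_of (cbox a b) \<Longrightarrow> \<gamma>1 fine p \<Longrightarrow>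
        norm ((\<Sum>(x,k)\<in>p. measure lborel k *\<^sub>R (indicator N x::real)) - 0) < \<delta>"
      using N0 \<open>\<delta> > 0\<close> unfolding has_integral by (metis (no_types, lifting))
    \<comment> \<open>Straddle estimate: since \<open>t\<close> lies between \<open>u\<close> and
      \<open>v\<close>, the errors \<open>e * (t - u)\<close> and \<open>e * (v - t)\<close> add up
      to \<open>e * (v - u)\<close>.\<close>
    have "\<exists>d>0. \<forall>u v. t \<in> {a..b} - N \<longrightarrow> u \<in> {a..b} \<longrightarrow> v \<in> {a..b} \<longrightarrow> u \<le> t \<longrightarrow> t \<le> v \<longrightarrow>
        {u..v} \<subseteq> ball t d \<longrightarrow> \<phi> v - \<phi> u \<le> e * (v - u)" for t
    proof (cases "t \<in> {a..b} - N")
      case True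
      then obtain D where D: "D \<le> 0" "(\<phi> has_real_derivative D) (at t within {a..b})"
        by (auto simp: N_def)
      obtain d where d: "d > 0" "\<And>y. y \<in> {a..b} \<Longrightarrow> norm (y - t) < d \<Longrightarrow>
          norm (\<phi> y - \<phi> t - D * (y - t)) \<le> e * norm (y - t)"
        using D(2) \<open>e > 0\<close> unfolding has_field_derivative_def has_derivative_within_alt by blast
      show ?thesis
      proof (intro exI[of _ d] conjI allI impI)
        fix u v assume uv: "u \<in> {a..b}" "v \<in> {a..b}" "u \<le> t" "t \<le> v" "{u..v} \<subseteq> ball t d"
        have "u \<in> {u..v}" "v \<in> {u..v}" using uv by auto
        then have "u \<in> ball t d" "v \<in> ball t d" using uv(5) by blast+
        then have "norm (\<phi> u - \<phi> t - D * (u - t)) \<le> e * norm (u - t)"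
          "norm (\<phi> v - \<phi> t - D * (v - t)) \<le> e * norm (v - t)"
          using uv d(2)[of u] d(2)[of v] by (simp_all add: dist_norm norm_minus_commute)
        moreover have "D * (v - u) \<le> 0" using D(1) uv by (simp add: mult_nonpos_nonneg)
        ultimately show "\<phi> v - \<phi> u \<le> e * (v - u)"
          using uv by (simp add: algebra_simps abs_if split: if_splits)
      qed (use d in auto)
    qed (auto intro: exI[of _ 1])
    then obtain d where d: "\<And>t. d t > 0" "\<And>t u v. t \<in> {a..b} - N \<Longrightarrow> u \<in> {a..b} \<Longrightarrow> v \<in> {a..b} \<Longrightarrow>
        u \<le> t \<Longrightarrow> t \<le> v \<Longrightarrow> {u..v} \<subseteq> ball t (d t) \<Longrightarrow> \<phi> v - \<phi> u \<le> e * (v - u)"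
      by metis
    have "gauge (\<lambda>t. \<gamma>1 t \<inter> ball t (d t))"
      using \<gamma>1(1) d(1) by (intro gauge_Int gauge_ball_dependent) auto
    then obtain p where p: "p tagged_division_of {a..b}" "(\<lambda>t. \<gamma>1 t \<inter> ball t (d t)) fine p"
      using fine_division_exists_real by blast
    then have fine1: "\<gamma>1 fine p" and fine2: "(\<lambda>t. ball t (d t)) fine p"
      by (auto simp: fine_Int)
    have fin: "finite p" using p(1) by blast
    have pK: "\<exists>u v. K = {u..v} \<and> u \<le> t \<and> t \<le> v \<and> a \<le> u \<and> v \<le> b \<and> Inf K = u \<and> Sup K = v
        \<and> measure lborel K = v - u" if "(t,K) \<in> p" for t K
    proof -
      have "t \<in> K" "K \<subseteq> {a..b}" "\<exists>u v. K = cbox u v"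
        using tagged_division_ofD(2-4)[OF p(1) that] by auto
      then show ?thesis by auto
    qed
    let ?g = "\<lambda>(x,K). \<phi> (Sup K) - \<phi> (Inf K)"
    \<comment> \<open>Degenerate cells are left out: their increment vanishes, and for the remaining
      ones disjointness of interiors gives the ordering of endpoints that absolute continuity asks
      for.\<close>
    let ?B = "{(x,K)\<in>p. x \<in> N \<and> Inf K < Sup K}"
    let ?G = "{(x,K)\<in>p. x \<notin> N}"
    have "\<phi> b - \<phi> a = sum ?g p"
      using additive_tagged_division_1[OF \<open>a \<le> b\<close> p(1), of \<phi>] by simp
    also have "\<dots> = sum ?g (?G \<union> ?B)"
    proof (rule sum.mono_neutral_right)
      show "\<forall>i\<in>p - (?G \<union> ?B). ?g i = 0"
      proof
        fix i assume i: "i \<in> p - (?G \<union> ?B)"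
        obtain t K where tK: "i = (t, K)" by force
        have "(t,K) \<in> p" "\<not> Inf K < Sup K" using i tK by auto
        then show "?g i = 0" using pK[of t K] tK by force
      qed
    qed (use fin in auto)
    also have "\<dots> = sum ?g ?G + sum ?g ?B"
      using fin by (intro sum.union_disjoint) (auto intro: rev_finite_subset)
    also have "sum ?g ?G \<le> (\<Sum>(x,K)\<in>?G. e * measure lborel K)"
    proof (intro sum_mono, clarify)
      fix t K assume tK: "(t,K) \<in> p" "t \<notin> N"
      then obtain u v where "K = {u..v}" "u \<le> t" "t \<le> v" "a \<le> u" "v \<le> b" "Inf K = u" "Sup K = v"
        "measure lborel K = v - u" using pK by blast
      moreover have "K \<subseteq> ball t (d t)" using fine2 tK by blast
      ultimately show "\<phi> (Sup K) - \<phi> (Inf K) \<le> e * measure lborel K" using d(2)[of t u v] tK by auto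
    qed
    also have "\<dots> \<le> (\<Sum>(x,K)\<in>p. e * measure lborel K)"
      using fin \<open>e > 0\<close> by (intro sum_mono2) auto
    also have "\<dots> = e * (\<Sum>(x,K)\<in>p. measure lborel K)"
      by (simp add: sum_distrib_left case_prod_unfold)
    also have "\<dots> = e * (b - a)"
      using additive_content_tagged_division[of p a b] p(1) \<open>a \<le> b\<close> by simp
    also have "sum ?g ?B \<le> e"
    proof -
      have finB: "finite ?B" using fin by (rule rev_finite_subset) auto
      obtain h where h: "bij_betw h {..<card ?B} ?B"
        using ex_bij_betw_nat_finite[OF finB] by (auto simp: atLeast0LessThan)
      define n where "n = card ?B"
      define u where "u = (\<lambda>k. Inf (snd (h k)))"
      define v where "v = (\<lambda>k. Sup (snd (h k)))"
      have hB: "h k \<in> ?B" if "k < n" for k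
        using bij_betwE[OF h] that by (simp add: n_def)
      have hK: "snd (h k) = {u k..v k} \<and> u k < v k \<and> a \<le> u k \<and> v k \<le> b
          \<and> measure lborel (snd (h k)) = v k - u k" if "k < n" for k
        using hB[OF that] pK[of "fst (h k)" "snd (h k)"] by (auto simp: u_def v_def)
      have reidx: "sum F ?B = (\<Sum>k<n. F (h k))" for F :: "real \<times> real set \<Rightarrow> real"
        using sum.reindex_bij_betw[OF h, of F] by (simp add: n_def)
      have "sum ?g ?B = (\<Sum>k<n. \<phi> (v k) - \<phi> (u k))"
        unfolding reidx by (simp add: case_prod_unfold u_def v_def)
      also have "\<dots> \<le> (\<Sum>k<n. norm (\<phi> (v k) - \<phi> (u k)))"
        by (intro sum_mono) simp
      also have "\<dots> < e"
      proof (rule \<delta>)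
        show "\<forall>k<n. u k \<le> v k \<and> {u k..v k} \<subseteq> {a..b}" using hK by fastforce
        show "\<forall>k<n. \<forall>l<n. k \<noteq> l \<longrightarrow> v k \<le> u l \<or> v l \<le> u k"
        proof (intro allI impI)
          fix k l assume kl: "k < n" "l < n" "k \<noteq> l"
          have "h k \<noteq> h l" using h kl by (auto simp: bij_betw_def inj_on_def n_def)
          then have "interior (snd (h k)) \<inter> interior (snd (h l)) = {}"
            using hB[OF kl(1)] hB[OF kl(2)]
              tagged_division_ofD(5)[OF p(1), of "fst (h k)" "snd (h k)" "fst (h l)" "snd (h l)"]
            by auto
          then have "{u k<..<v k} \<inter> {u l<..<v l} = {}"
            using hK[OF kl(1)] hK[OF kl(2)] by simp
          \<comment> \<open>If two cells overlapped, the midpoint of the overlap would lie in both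
            open cells.\<close>
          moreover have "max (u k) (u l) < min (v k) (v l) \<Longrightarrow>
             (max (u k) (u l) + min (v k) (v l)) / 2 \<in> {u k<..<v k} \<inter> {u l<..<v l}"
            by auto
          ultimately have "\<not> max (u k) (u l) < min (v k) (v l)" by blast
          then show "v k \<le> u l \<or> v l \<le> u k" using hK[OF kl(1)] hK[OF kl(2)] by auto
        qed
        have "(\<Sum>k<n. v k - u k) = (\<Sum>(x,K)\<in>?B. measure lborel K)"
          unfolding reidx
        proof (intro sum.cong refl)
          fix k assume "k \<in> {..<n}"
          then have "measure lborel (snd (h k)) = v k - u k" using hK[of k] by blast
          then show "v k - u k = (case h k of (x, K) \<Rightarrow> measure lborel K)"
            by (simp only: case_prod_unfold)
        qed
        also have "\<dots> = (\<Sum>(x,K)\<in>?B. measure lborel K *\<^sub>R (indicator N x::real))"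
          by (intro sum.cong) auto
        also have "\<dots> \<le> (\<Sum>(x,K)\<in>p. measure lborel K *\<^sub>R (indicator N x::real))"
          using fin by (intro sum_mono2) auto
        also have "\<dots> < \<delta>" using \<gamma>1(2)[of p] p(1) fine1 by auto
        finally show "(\<Sum>k<n. v k - u k) < \<delta>" .
      qed
      finally show ?thesis by simp
    qed
    finally show ?thesis by simp
  qed
  show ?thesis
  proof (rule ccontr)
    assume "\<not> \<phi> b \<le> \<phi> a"
    then have pos: "\<phi> b - \<phi> a > 0" by simp
    \<comment> \<open>With this \<open>e\<close> the bound \<open>e * (b - a) + e\<close> is half of
      the supposed increase.\<close>
    define e where "e = (\<phi> b - \<phi> a) / (2 * (b - a + 1))"
    have "e > 0" using pos \<open>a \<le> b\<close> by (simp add: e_def)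
    have "e * (b - a) + e = (\<phi> b - \<phi> a) / 2"
    proof -
      have "y / (2 * c) * c = y / 2" if "c > 0" for y c :: real
        using that by simp
      from this[of "b - a + 1"] have "e * (b - a + 1) = (\<phi> b - \<phi> a) / 2"
        using \<open>a \<le> b\<close> unfolding e_def by auto
      then show ?thesis by (simp add: distrib_left)
    qed
    then show False using step[OF \<open>e > 0\<close>] pos by simp
  qed
qed

section \<open>Closure properties of absolute continuity\<close>

text \<open>Inner products, differences and Lipschitz functions all have increments controlled by
  those of at most two absolutely continuous functions; this is the common
  \<open>\<epsilon>\<close>-\<open>\<delta>\<close> argument.\<close>

lemma abs_cont_on_dominated:
  assumes f: "abs_cont_on I f" and g: "abs_cont_on I g"
    and le: "\<And>u v. u \<in> I \<Longrightarrow> v \<in> I \<Longrightarrow>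
      norm (\<phi> v - \<phi> u) \<le> K * (norm (f v - f u) + norm (g v - g u))"
  shows "abs_cont_on I \<phi>"
  unfolding abs_cont_on_def
proof (intro allI impI)
  fix \<epsilon> :: real assume "\<epsilon> > 0"
  \<comment> \<open>\<open>\<bar>K\<bar> + 1\<close> is positive whatever the sign of
    \<open>K\<close>; the factor \<open>2\<close> shares \<open>\<epsilon>\<close> between
    \<open>f\<close> and \<open>g\<close>.\<close>
  define e where "e = \<epsilon> / (2 * (\<bar>K\<bar> + 1))"
  have "e > 0" using \<open>\<epsilon> > 0\<close> by (simp add: e_def add_nonneg_pos)
  obtain d1 where d1: "d1 > 0" "\<And>n (a::nat \<Rightarrow> real) b.
      (\<forall>k<n. a k \<le> b k \<and> {a k..b k} \<subseteq> I) \<Longrightarrow>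
      (\<forall>k<n. \<forall>l<n. k \<noteq> l \<longrightarrow> b k \<le> a l \<or> b l \<le> a k) \<Longrightarrow>
      (\<Sum>k<n. b k - a k) < d1 \<Longrightarrow> (\<Sum>k<n. norm (f (b k) - f (a k))) < e"
    by (rule abs_cont_onE[OF f \<open>e > 0\<close>], rule that)
  obtain d2 where d2: "d2 > 0" "\<And>n (a::nat \<Rightarrow> real) b.
      (\<forall>k<n. a k \<le> b k \<and> {a k..b k} \<subseteq> I) \<Longrightarrow>
      (\<forall>k<n. \<forall>l<n. k \<noteq> l \<longrightarrow> b k \<le> a l \<or> b l \<le> a k) \<Longrightarrow>
      (\<Sum>k<n. b k - a k) < d2 \<Longrightarrow> (\<Sum>k<n. norm (g (b k) - g (a k))) < e"
    by (rule abs_cont_onE[OF g \<open>e > 0\<close>], rule that)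
  show "\<exists>\<delta>>0. \<forall>n (a::nat \<Rightarrow> real) b.
      (\<forall>k<n. a k \<le> b k \<and> {a k..b k} \<subseteq> I) \<and>
      (\<forall>k<n. \<forall>l<n. k \<noteq> l \<longrightarrow> b k \<le> a l \<or> b l \<le> a k) \<and>
      (\<Sum>k<n. b k - a k) < \<delta> \<longrightarrow> (\<Sum>k<n. norm (\<phi> (b k) - \<phi> (a k))) < \<epsilon>"
  proof (intro exI[of _ "min d1 d2"] conjI allI impI; (elim conjE)?)
    fix n and a b :: "nat \<Rightarrow> real"
    assume ab: "\<forall>k<n. a k \<le> b k \<and> {a k..b k} \<subseteq> I"
      "\<forall>k<n. \<forall>l<n. k \<noteq> l \<longrightarrow> b k \<le> a l \<or> b l \<le> a k" "(\<Sum>k<n. b k - a k) < min d1 d2"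
    let ?s = "\<lambda>h. (\<Sum>k<n. norm (h (b k) - h (a k)))"
    have mem: "a k \<in> I \<and> b k \<in> I" if "k < n" for k
      using ab(1) that by (metis atLeastAtMost_iff order_refl subset_iff)
    have "?s \<phi> \<le> (\<Sum>k<n. (\<bar>K\<bar> + 1) * (norm (f (b k) - f (a k)) + norm (g (b k) - g (a k))))"
    proof (intro sum_mono)
      fix k assume "k \<in> {..<n}"
      then have "norm (\<phi> (b k) - \<phi> (a k)) \<le> K * (norm (f (b k) - f (a k)) + norm (g (b k) - g (a k)))"
        using le mem by auto
      also have "\<dots> \<le> (\<bar>K\<bar> + 1) * (norm (f (b k) - f (a k)) + norm (g (b k) - g (a k)))"
        by (intro mult_right_mono) auto
      finally show "norm (\<phi> (b k) - \<phi> (a k)) \<le> \<dots>" .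
    qed
    also have "\<dots> = (\<bar>K\<bar> + 1) * (?s f + ?s g)"
      by (simp add: sum.distrib flip: sum_distrib_left)
    also have "\<dots> < (\<bar>K\<bar> + 1) * (e + e)"
      using d1(2)[of n a b] d2(2)[of n a b] ab
      by (intro mult_strict_left_mono add_strict_mono) auto
    also have "\<dots> = \<epsilon>"
    proof -
      have "c * (\<epsilon> / (2 * c) + \<epsilon> / (2 * c)) = \<epsilon>" if "c > 0" for c :: real
        using that by (simp add: field_simps)
      from this[of "\<bar>K\<bar> + 1"] show ?thesis by (simp only: e_def)
    qed
    finally show "?s \<phi> < \<epsilon>" .
  qed (use d1 d2 in auto)
qed

lemma abs_cont_on_lipschitz:
  assumes "\<And>u v. u \<in> I \<Longrightarrow> v \<in> I \<Longrightarrow> norm (\<phi> v - \<phi> u) \<le> K * \<bar>v - u\<bar>"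
  shows "abs_cont_on I \<phi>"
proof -
  have "abs_cont_on I (\<lambda>t::real. t)"
    unfolding abs_cont_on_def
  proof (intro allI impI)
    fix \<epsilon> :: real assume "\<epsilon> > 0"
    have eq: "(\<Sum>k<n. norm (b k - a k)) = (\<Sum>k<n. b k - a k)"
      if "\<forall>k<n. a k \<le> b k \<and> {a k..b k} \<subseteq> I" for n and a b :: "nat \<Rightarrow> real"
      using that by (intro sum.cong) auto
    show "\<exists>\<delta>>0. \<forall>n (a::nat \<Rightarrow> real) b.
      (\<forall>k<n. a k \<le> b k \<and> {a k..b k} \<subseteq> I) \<and>
      (\<forall>k<n. \<forall>l<n. k \<noteq> l \<longrightarrow> b k \<le> a l \<or> b l \<le> a k) \<and>
      (\<Sum>k<n. b k - a k) < \<delta> \<longrightarrow> (\<Sum>k<n. norm (b k - a k)) < \<epsilon>"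
    proof (intro exI[of _ \<epsilon>] conjI allI impI, goal_cases)
      case (2 n a b)
      then show ?case using eq by metis
    qed (fact \<open>\<epsilon> > 0\<close>)
  qed
  then show ?thesis
    \<comment> \<open>The identity serves as both control functions, hence half of
      \<open>K\<close>.\<close>
    by (rule abs_cont_on_dominated[of _ _ _ _ "K/2"], assumption) (use assms in auto)
qed

lemma abs_cont_on_C1:
  fixes \<phi> :: "real \<Rightarrow> 'a::real_normed_vector"
  assumes "\<And>t. t \<in> {a..b} \<Longrightarrow> (\<phi> has_vector_derivative \<phi>' t) (at t within {a..b})"
    and "continuous_on {a..b} \<phi>'"
  shows "abs_cont_on {a..b} \<phi>"
proof -
  have "bounded (\<phi>' ` {a..b})"
    using assms(2) compact_continuous_image compact_imp_bounded by blast
  then obtain K where K: "\<And>t. t \<in> {a..b} \<Longrightarrow> norm (\<phi>' t) \<le> K"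
    unfolding bounded_iff by blast
  have "norm (\<phi> v - \<phi> u) \<le> K * \<bar>v - u\<bar>" if "u \<in> {a..b}" "v \<in> {a..b}" for u v
    unfolding real_norm_def[symmetric]
  proof (rule differentiable_bound[of "{a..b}" \<phi> "\<lambda>t h. h *\<^sub>R \<phi>' t"])
    show "(\<phi> has_derivative (\<lambda>h. h *\<^sub>R \<phi>' t)) (at t within {a..b})" if "t \<in> {a..b}" for t
      using assms(1)[OF that] by (simp add: has_vector_derivative_def)
    show "onorm (\<lambda>h. h *\<^sub>R \<phi>' t) \<le> K" if "t \<in> {a..b}" for t
      using K[OF that] by (intro onorm_le) (simp add: mult.commute[of K] mult_left_mono)
  qed (use that in auto)
  then show ?thesis by (rule abs_cont_on_lipschitz)
qed

lemma abs_cont_on_imp_continuous_on: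
  assumes "abs_cont_on {a..b} \<phi>"
  shows "continuous_on {a..b} \<phi>"
  unfolding continuous_on_iff
proof (intro ballI allI impI)
  fix t e :: real assume t: "t \<in> {a..b}" and "e > 0"
  obtain \<delta> where "\<delta> > 0" and \<delta>: "\<And>n (u::nat \<Rightarrow> real) v.
        (\<forall>k<n. u k \<le> v k \<and> {u k..v k} \<subseteq> {a..b}) \<Longrightarrow>
        (\<forall>k<n. \<forall>l<n. k \<noteq> l \<longrightarrow> v k \<le> u l \<or> v l \<le> u k) \<Longrightarrow>
        (\<Sum>k<n. v k - u k) < \<delta> \<Longrightarrow> (\<Sum>k<n. norm (\<phi> (v k) - \<phi> (u k))) < e"
    by (rule abs_cont_onE[OF assms \<open>e > 0\<close>], rule that)
  show "\<exists>d>0. \<forall>s\<in>{a..b}. dist s t < d \<longrightarrow> dist (\<phi> s) (\<phi> t) < e"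
  proof (intro exI[of _ \<delta>] conjI ballI impI)
    fix s assume "s \<in> {a..b}" "dist s t < \<delta>"
    then show "dist (\<phi> s) (\<phi> t) < e"
      \<comment> \<open>A family of one interval, in both orientations because \<open>s\<close> may
        lie on either side of \<open>t\<close>.\<close>
      using \<delta>[of 1 "\<lambda>_. s" "\<lambda>_. t"] \<delta>[of 1 "\<lambda>_. t" "\<lambda>_. s"] t
      by (cases s t rule: linorder_cases)
        (auto simp: dist_norm norm_minus_commute abs_if \<open>e > 0\<close> split: if_splits)
  qed fact
qed

lemma abs_cont_on_inner:
  assumes f: "abs_cont_on {a..b} f" and g: "abs_cont_on {a..b} g"
  shows "abs_cont_on {a..b} (\<lambda>t. f t \<bullet> g t)"
proof -
  have "bounded (f ` {a..b})" "bounded (g ` {a..b})"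
    using f g abs_cont_on_imp_continuous_on compact_continuous_image compact_imp_bounded
    by blast+
  then obtain K L where K: "\<And>t. t \<in> {a..b} \<Longrightarrow> norm (f t) \<le> K"
    and L: "\<And>t. t \<in> {a..b} \<Longrightarrow> norm (g t) \<le> L"
    unfolding bounded_iff by blast
  show ?thesis
  proof (rule abs_cont_on_dominated[OF f g, of _ "max K L"])
    fix u v assume uv: "u \<in> {a..b}" "v \<in> {a..b}"
    have "f v \<bullet> g v - f u \<bullet> g u = (f v - f u) \<bullet> g v + f u \<bullet> (g v - g u)"
      by (simp add: inner_diff)
    then have "norm (f v \<bullet> g v - f u \<bullet> g u) \<le> \<bar>(f v - f u) \<bullet> g v\<bar> + \<bar>f u \<bullet> (g v - g u)\<bar>"
      by simp
    also have "\<dots> \<le> norm (f v - f u) * norm (g v) + norm (f u) * norm (g v - g u)"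
      by (intro add_mono Cauchy_Schwarz_ineq2)
    also have "\<dots> \<le> norm (f v - f u) * max K L + max K L * norm (g v - g u)"
      using K[OF uv(1)] L[OF uv(2)] by (intro add_mono mult_left_mono mult_right_mono) auto
    finally show "norm (f v \<bullet> g v - f u \<bullet> g u) \<le> max K L * (norm (f v - f u) + norm (g v - g u))"
      by (simp add: algebra_simps)
  qed
qed

lemma abs_cont_on_diff:
  assumes "abs_cont_on I f" and "abs_cont_on I g"
  shows "abs_cont_on I (\<lambda>t. f t - g t)"
  using assms(1,2)
proof (rule abs_cont_on_dominated[of _ _ _ _ 1])
  fix u v
  have "f v - g v - (f u - g u) = (f v - f u) - (g v - g u)" by simp
  then show "norm (f v - g v - (f u - g u)) \<le> 1 * (norm (f v - f u) + norm (g v - g u))"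
    by (metis mult_1 norm_triangle_ineq4)
qed

text \<open>The form in which almost-everywhere differential inequalities are integrated: \<open>\<Psi>\<close> is an
  explicit antiderivative of the majorant \<open>\<psi>\<close>.\<close>
lemma abs_cont_on_diff_antimono:
  fixes g \<Psi> :: "real \<Rightarrow> real"
  assumes ac: "\<And>T. abs_cont_on {a..T} g"
    and \<Psi>: "\<And>t. t \<ge> a \<Longrightarrow> (\<Psi> has_real_derivative \<psi> t) (at t)"
    and cont: "continuous_on {a..} \<psi>"
    and ae: "AE t in lebesgue. t \<ge> a \<longrightarrow> (\<exists>D\<le>\<psi> t. (g has_real_derivative D) (at t))"
    and st: "a \<le> s" "s \<le> t"
  shows "g t - \<Psi> t \<le> g s - \<Psi> s"
proof (rule abs_cont_on_antimono[OF \<open>s \<le> t\<close>])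
  have "abs_cont_on {s..t} g"
    using st by (intro abs_cont_on_subset[OF ac[of t]]) auto
  moreover have "abs_cont_on {s..t} \<Psi>"
  proof (rule abs_cont_on_C1)
    show "(\<Psi> has_vector_derivative \<psi> r) (at r within {s..t})" if "r \<in> {s..t}" for r
      using \<Psi>[of r] that st has_vector_derivative_at_within[of \<Psi> "\<psi> r" r "{s..t}"]
      by (simp add: has_real_derivative_iff_has_vector_derivative)
  qed (use st in \<open>auto intro: continuous_on_subset[OF cont]\<close>)
  ultimately show "abs_cont_on {s..t} (\<lambda>t. g t - \<Psi> t)" by (rule abs_cont_on_diff)
  show "AE r in lebesgue. r \<in> {s..t} \<longrightarrow>
      (\<exists>D\<le>0. ((\<lambda>t. g t - \<Psi> t) has_real_derivative D) (at r within {s..t}))"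
    using ae
  proof eventually_elim
    case (elim r)
    show ?case
    proof
      assume r: "r \<in> {s..t}"
      then obtain D where "D \<le> \<psi> r" "(g has_real_derivative D) (at r)" using elim st by auto
      then have "((\<lambda>t. g t - \<Psi> t) has_real_derivative D - \<psi> r) (at r)"
        using \<Psi>[of r] r st by (intro DERIV_diff) auto
      then have "((\<lambda>t. g t - \<Psi> t) has_real_derivative D - \<psi> r) (at r within {s..t})"
        by (rule has_field_derivative_at_within)
      then show "\<exists>D\<le>0. ((\<lambda>t. g t - \<Psi> t) has_real_derivative D) (at r within {s..t})"
        using \<open>D \<le> \<psi> r\<close> by (intro exI[of _ "D - \<psi> r"]) auto
    qed
  qed
qed

section \<open>Weak convergence in Hilbert spaces\<close>

text \<open>The representing vector is the minimizer of \<open>(norm u)\<^sup>2 / 2 - L u\<close>.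
  Completeness supplies it as the limit of a minimizing sequence, and perturbing it in direction
  \<open>v\<close> identifies \<open>L v\<close>.\<close>

lemma riesz_representation:
  fixes L :: "'a::{real_inner,complete_space} \<Rightarrow> real"
  assumes add: "\<And>u v. L (u + v) = L u + L v" and scale: "\<And>c u. L (c *\<^sub>R u) = c * L u"
    and bound: "\<And>u. \<bar>L u\<bar> \<le> M * norm u"
  obtains z where "\<And>u. L u = z \<bullet> u"
proof -
  define J where "J = (\<lambda>u. (norm u)\<^sup>2 / 2 - L u)"
  have lower: "J u \<ge> - M\<^sup>2 / 2" for u
  proof -
    have "L u \<le> M * norm u" using bound[of u] by simp
    moreover have "0 \<le> (norm u - M)\<^sup>2" by simp
    ultimately show ?thesis by (simp add: J_def power2_eq_square algebra_simps)
  qed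
  then have bdd: "bdd_below (range J)" by (auto simp: bdd_below_def)
  define m where "m = Inf (range J)"
  have mle: "m \<le> J u" for u unfolding m_def using bdd by (simp add: cInf_lower)
  have "\<exists>u. J u < m + inverse (Suc n)" for n
    using cInf_lessD[of "range J" "m + inverse (Suc n)"] by (auto simp: m_def)
  then obtain u where u: "\<And>n. J (u n) < m + inverse (Suc n)" by metis
  have neg: "L (v - w) = L v - L w" for v w
    using add[of v "(-1) *\<^sub>R w"] scale[of "-1" w] by simp
  \<comment> \<open>Parallelogram law, with \<open>m\<close> bounding \<open>J\<close> from below at
    the midpoint: near-minimizers are close to each other.\<close>
  have para: "(norm (v - w))\<^sup>2 \<le> 4 * (J v - m) + 4 * (J w - m)" for v w
  proof -
    have "L ((1/2) *\<^sub>R (v + w)) = (L v + L w) / 2" by (simp add: scale add)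
    moreover have "(norm ((1/2) *\<^sub>R (v + w)))\<^sup>2 = ((norm (v + w)) / 2)\<^sup>2" by simp
    ultimately have "m \<le> (norm (v + w) / 2)\<^sup>2 / 2 - (L v + L w) / 2"
      using mle[of "(1/2) *\<^sub>R (v + w)"] unfolding J_def by (simp only:)
    moreover have "(norm (v + w))\<^sup>2 + (norm (v - w))\<^sup>2 = 2 * (norm v)\<^sup>2 + 2 * (norm w)\<^sup>2"
      by (simp add: power2_norm_eq_inner inner_add inner_diff inner_commute)
    moreover have "N \<le> 4 * (a / 2 - l - m) + 4 * (b / 2 - l' - m)"
      if "m \<le> (P / 2\<^sup>2) / 2 - (l + l') / 2" "P + N = 2 * a + 2 * b" for P N a b l l' :: real
      using that by (simp add: field_simps)
    ultimately show ?thesis unfolding J_def power_divide by blast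
  qed
  have "Cauchy u"
  proof (rule metric_CauchyI)
    fix e :: real assume "e > 0"
    then obtain N where N: "inverse (real (Suc N)) < e\<^sup>2 / 8"
      using reals_Archimedean[of "e\<^sup>2/8"] by auto
    show "\<exists>N. \<forall>i\<ge>N. \<forall>j\<ge>N. dist (u i) (u j) < e"
    proof (intro exI[of _ N] allI impI)
      fix i j assume ij: "N \<le> i" "N \<le> j"
      have small: "J (u k) - m < e\<^sup>2 / 8" if "N \<le> k" for k
      proof -
        have "inverse (real (Suc k)) \<le> inverse (real (Suc N))"
          using that by (intro le_imp_inverse_le) auto
        then show ?thesis using u[of k] N by linarith
      qed
      have "(norm (u i - u j))\<^sup>2 < e\<^sup>2"
        using para[of "u i" "u j"] small[OF ij(1)] small[OF ij(2)] by argo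
      then show "dist (u i) (u j) < e" using \<open>e > 0\<close>
        by (simp add: dist_norm power2_less_imp_less)
    qed
  qed
  then obtain z where z: "u \<longlonglongrightarrow> z" using Cauchy_convergent convergent_def by blast
  have Lz: "(\<lambda>n. L (u n)) \<longlonglongrightarrow> L z"
  proof -
    have "(\<lambda>n. M * norm (u n - z)) \<longlonglongrightarrow> 0"
      using tendsto_mult_right_zero[OF tendsto_norm_zero[OF LIM_zero[OF z]]] .
    then have "(\<lambda>n. L (u n) - L z) \<longlonglongrightarrow> 0"
      by (rule Lim_null_comparison[rotated]) (use bound in \<open>auto simp flip: neg\<close>)
    then show ?thesis by (rule LIM_zero_cancel)
  qed
  have "J z \<le> m"
  proof (rule LIMSEQ_le)
    show "(\<lambda>n. J (u n)) \<longlonglongrightarrow> J z" unfolding J_def by (intro tendsto_intros z Lz) simp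
    show "(\<lambda>n. m + inverse (real (Suc n))) \<longlonglongrightarrow> m"
      using tendsto_add[OF tendsto_const LIMSEQ_inverse_real_of_nat] by simp
  qed (use u in \<open>auto intro: less_imp_le\<close>)
  have "L v = z \<bullet> v" for v
  proof (rule ccontr)
    assume ne: "L v \<noteq> z \<bullet> v"
    define d where "d = L v - z \<bullet> v"
    have "v \<noteq> 0" using ne bound[of 0] by auto
    \<comment> \<open>This \<open>s\<close> minimizes the quadratic polynomial
      \<open>J (z + s *\<^sub>R v)\<close> in \<open>s\<close>; the gain is
      \<open>d\<^sup>2 / (norm v)\<^sup>2 / 2\<close>.\<close>
    define s where "s = d / (norm v)\<^sup>2"
    have "(norm (z + s *\<^sub>R v))\<^sup>2 = (norm z)\<^sup>2 + 2 * s * (z \<bullet> v) + s\<^sup>2 * (norm v)\<^sup>2"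
      unfolding power2_norm_eq_inner
      by (simp add: inner_add inner_commute power2_eq_square algebra_simps)
    then have "J (z + s *\<^sub>R v) = J z + s * (z \<bullet> v) + s\<^sup>2 * (norm v)\<^sup>2 / 2 - s * L v"
      by (simp add: J_def add scale add_divide_distrib)
    also have "\<dots> = J z - d\<^sup>2 / (norm v)\<^sup>2 / 2"
    proof -
      have "j + d / n * c + (d / n)\<^sup>2 * n / 2 - d / n * (c + d) = j - d\<^sup>2 / n / 2"
        if "n \<noteq> 0" for j c n :: real
        using that by (simp add: field_simps power2_eq_square)
      from this[of "(norm v)\<^sup>2" "J z" "z \<bullet> v"] show ?thesis
        using \<open>v \<noteq> 0\<close> by (simp add: s_def d_def)
    qed
    also have "\<dots> < J z" using ne \<open>v \<noteq> 0\<close> by (simp add: d_def)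
    finally show False using mle[of "z + s *\<^sub>R v"] \<open>J z \<le> m\<close> by simp
  qed
  then show ?thesis using that by blast
qed

text \<open>Banach-Alaoglu by way of Tychonoff: the functionals \<open>x t \<bullet> u\<close> stay
  in a product of compact intervals, hence cluster there at some \<open>L\<close>. Limits along a
  finer filter make \<open>L\<close> linear and bounded, so the Riesz representation yields the
  point. Filters take the place of subsequences, as the product topology need not be
  metrizable.\<close>

lemma bounded_weak_cluster:
  fixes x :: "'b \<Rightarrow> 'a::{real_inner,complete_space}"
  assumes F: "F \<noteq> bot" and bdd: "\<forall>\<^sub>F t in F. norm (x t) \<le> M"
  obtains G z where "G \<noteq> bot" "G \<le> F" "\<And>u. ((\<lambda>t. x t \<bullet> u) \<longlongrightarrow> z \<bullet> u) G"
proof -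
  define \<Phi> where "\<Phi> = (\<lambda>t u. x t \<bullet> u)"
  define U :: "('a \<Rightarrow> real) set" where "U = PiE UNIV (\<lambda>u. {- M * norm u..M * norm u})"
  have "compact U"
    using compactin_PiE[of "\<lambda>_::'a. euclidean :: real topology" UNIV
        "\<lambda>u. {- M * norm u..M * norm u}"]
    by (simp add: U_def euclidean_product_topology)
  moreover have "filtermap \<Phi> F \<noteq> bot" using F by (simp add: filtermap_bot_iff)
  moreover have "\<forall>\<^sub>F L in filtermap \<Phi> F. L \<in> U"
    unfolding eventually_filtermap using bdd
  proof eventually_elim
    case (elim t)
    have "\<bar>x t \<bullet> u\<bar> \<le> M * norm u" for u
      using Cauchy_Schwarz_ineq2[of "x t" u] mult_right_mono[OF elim norm_ge_zero[of u]] by linarith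
    then have "- (M * norm u) \<le> x t \<bullet> u \<and> x t \<bullet> u \<le> M * norm u" for u
      by (metis abs_le_D1 abs_le_D2 minus_le_iff)
    then show ?case by (auto simp: U_def \<Phi>_def)
  qed
  ultimately obtain L where L: "L \<in> U" "inf (nhds L) (filtermap \<Phi> F) \<noteq> bot"
    unfolding compact_filter by blast
  \<comment> \<open>\<open>G\<close> refines \<open>F\<close> to the times at which the functional
    of \<open>x t\<close> is close to \<open>L\<close>; it is proper because \<open>L\<close> is a
    cluster point.\<close>
  define G where "G = inf F (filtercomap \<Phi> (nhds L))"
  have "G \<noteq> bot"
  proof
    assume "G = bot"
    then have "eventually (\<lambda>_. False) G" by simp
    then obtain P Q where P: "eventually P F" and Q: "eventually Q (filtercomap \<Phi> (nhds L))"
      and PQ: "\<And>t. P t \<Longrightarrow> Q t \<Longrightarrow> False"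
      unfolding G_def eventually_inf by blast
    obtain R where R: "eventually R (nhds L)" "\<And>t. R (\<Phi> t) \<Longrightarrow> Q t"
      using Q unfolding eventually_filtercomap by blast
    have "eventually (\<lambda>l. \<not> R l) (filtermap \<Phi> F)"
      unfolding eventually_filtermap using P by eventually_elim (use PQ R in blast)
    then have "eventually (\<lambda>_. False) (inf (nhds L) (filtermap \<Phi> F))"
      unfolding eventually_inf using R(1) by (intro exI[of _ R] exI[of _ "\<lambda>l. \<not> R l"]) auto
    then show False using L(2) by (simp add: trivial_limit_def)
  qed
  moreover have "G \<le> F" by (simp add: G_def)
  moreover have lim: "((\<lambda>t. x t \<bullet> u) \<longlongrightarrow> L u) G" for u
  proof -
    have "filterlim \<Phi> (nhds L) G"
      unfolding G_def filterlim_def filtermap_le_iff_le_filtercomap by simp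
    moreover have "continuous_on UNIV (\<lambda>l :: 'a \<Rightarrow> real. l u)"
      by (rule continuous_on_product_coordinates)
    then have "((\<lambda>l. l u) \<longlongrightarrow> L u) (at L)" by (simp add: continuous_on_def)
    then have "((\<lambda>l. l u) \<longlongrightarrow> L u) (nhds L)"
      using tendsto_at_iff_tendsto_nhds[of "\<lambda>l :: 'a \<Rightarrow> real. l u" L] by simp
    ultimately show ?thesis using filterlim_compose by (force simp: \<Phi>_def)
  qed
  moreover obtain z where "\<And>u. L u = z \<bullet> u"
  proof (rule riesz_representation[of L M])
    fix u v and c :: real
    have "((\<lambda>t. x t \<bullet> (u + v)) \<longlongrightarrow> L u + L v) G"
      using tendsto_add[OF lim lim] by (simp add: inner_add)
    then show "L (u + v) = L u + L v" using tendsto_unique \<open>G \<noteq> bot\<close> lim by blast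
    have "((\<lambda>t. x t \<bullet> (c *\<^sub>R u)) \<longlongrightarrow> c * L u) G"
      using tendsto_mult[OF tendsto_const lim] by simp
    then show "L (c *\<^sub>R u) = c * L u" using tendsto_unique \<open>G \<noteq> bot\<close> lim by blast
    have "L u \<in> {- M * norm u..M * norm u}" using L(1) unfolding U_def by (rule PiE_mem) simp
    then show "\<bar>L u\<bar> \<le> M * norm u" by (simp add: abs_le_iff)
  qed (rule that)
  ultimately show ?thesis using that by metis
qed

text \<open>For cluster points \<open>z\<close> and \<open>z'\<close>, expanding the squared
  distances shows that \<open>x t \<bullet> (z - z')\<close> converges. Its limit is
  \<open>z \<bullet> (z - z')\<close> along one filter and \<open>z' \<bullet> (z - z')\<close>
  along the other, so \<open>z = z'\<close>. A bounded path with a single weak cluster point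
  converges weakly.\<close>

lemma opial:
  fixes x :: "real \<Rightarrow> 'a::{real_inner,complete_space}"
  assumes bdd: "\<forall>\<^sub>F t in at_top. norm (x t) \<le> M"
    and dist: "\<And>z. z \<in> S \<Longrightarrow> \<exists>l. ((\<lambda>t. (norm (x t - z))\<^sup>2) \<longlongrightarrow> l) at_top"
    and cluster: "\<And>G z. G \<noteq> bot \<Longrightarrow> G \<le> at_top \<Longrightarrow> (\<And>u. ((\<lambda>t. x t \<bullet> u) \<longlongrightarrow> z \<bullet> u) G) \<Longrightarrow> z \<in> S"
  shows "\<exists>z\<in>S. \<forall>u. ((\<lambda>t. x t \<bullet> u) \<longlongrightarrow> z \<bullet> u) at_top"
proof -
  have unique: "z = z'"
    if G: "G \<noteq> bot" "G \<le> at_top" "\<And>u. ((\<lambda>t. x t \<bullet> u) \<longlongrightarrow> z \<bullet> u) G"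
      and G': "G' \<noteq> bot" "G' \<le> at_top" "\<And>u. ((\<lambda>t. x t \<bullet> u) \<longlongrightarrow> z' \<bullet> u) G'" for G G' z z'
  proof -
    obtain l l' where "((\<lambda>t. (norm (x t - z))\<^sup>2) \<longlongrightarrow> l) at_top"
      "((\<lambda>t. (norm (x t - z'))\<^sup>2) \<longlongrightarrow> l') at_top"
      using dist cluster[OF G] cluster[OF G'] by metis
    then have "((\<lambda>t. ((norm (x t - z'))\<^sup>2 - (norm (x t - z))\<^sup>2 + (norm z)\<^sup>2 - (norm z')\<^sup>2) / 2)
        \<longlongrightarrow> (l' - l + (norm z)\<^sup>2 - (norm z')\<^sup>2) / 2) at_top"
      by (intro tendsto_intros) auto
    moreover have "(\<lambda>t. ((norm (x t - z'))\<^sup>2 - (norm (x t - z))\<^sup>2 + (norm z)\<^sup>2 - (norm z')\<^sup>2) / 2)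
        = (\<lambda>t. x t \<bullet> (z - z'))"
      by (rule ext) (simp add: power2_norm_eq_inner inner_diff inner_commute field_simps)
    ultimately obtain c where "((\<lambda>t. x t \<bullet> (z - z')) \<longlongrightarrow> c) at_top" by auto
    then have "((\<lambda>t. x t \<bullet> (z - z')) \<longlongrightarrow> c) G" "((\<lambda>t. x t \<bullet> (z - z')) \<longlongrightarrow> c) G'"
      using G(2) G'(2) by (auto elim: tendsto_mono[rotated])
    then have "z \<bullet> (z - z') = c" "z' \<bullet> (z - z') = c"
      using tendsto_unique G G' by blast+
    then have "(z - z') \<bullet> (z - z') = 0" by (simp add: inner_diff_left)
    then show ?thesis by simp
  qed
  obtain G z where G: "G \<noteq> bot" "G \<le> at_top" "\<And>u. ((\<lambda>t. x t \<bullet> u) \<longlongrightarrow> z \<bullet> u) G"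
    using bounded_weak_cluster[OF trivial_limit_at_top_linorder bdd] by metis
  have "((\<lambda>t. x t \<bullet> u) \<longlongrightarrow> z \<bullet> u) at_top" for u
  proof (rule ccontr)
    assume "\<not> ((\<lambda>t. x t \<bullet> u) \<longlongrightarrow> z \<bullet> u) at_top"
    then obtain e where e: "e > 0" "\<not> (\<forall>\<^sub>F t in at_top. dist (x t \<bullet> u) (z \<bullet> u) < e)"
      by (auto simp: tendsto_iff)
    \<comment> \<open>The times at which \<open>x t \<bullet> u\<close> stays away from
      \<open>z \<bullet> u\<close>: a cluster point taken along them equals \<open>z\<close> by
      uniqueness, a contradiction.\<close>
    define F where "F = inf at_top (principal {t. e \<le> dist (x t \<bullet> u) (z \<bullet> u)})"
    have "F \<noteq> bot"
      using e(2) by (auto simp: F_def trivial_limit_def eventually_inf_principal not_le)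
    moreover have "\<forall>\<^sub>F t in F. norm (x t) \<le> M"
      using bdd by (auto simp: F_def eventually_inf_principal elim: eventually_mono)
    ultimately obtain G' z' where G': "G' \<noteq> bot" "G' \<le> F" "\<And>u. ((\<lambda>t. x t \<bullet> u) \<longlongrightarrow> z' \<bullet> u) G'"
      using bounded_weak_cluster by metis
    have "G' \<le> at_top" using G'(2) by (simp add: F_def)
    then have "z' = z" using unique G G' by metis
    have "\<forall>\<^sub>F t in G'. dist (x t \<bullet> u) (z \<bullet> u) < e"
      using G'(3)[of u] e(1) \<open>z' = z\<close> by (simp add: tendsto_iff)
    moreover have "\<forall>\<^sub>F t in G'. e \<le> dist (x t \<bullet> u) (z \<bullet> u)"
      using G'(2) by (auto simp: F_def le_inf_iff le_principal)
    ultimately have "\<forall>\<^sub>F t in G'. False" by eventually_elim simp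
    then show False using G'(1) by (simp add: trivial_limit_def)
  qed
  then show ?thesis using cluster[OF G] by blast
qed

text \<open>Since \<open>proj\<close> is a definite description, a nearest point must first be shown
  to exist, by compactness, and to be unique, by convexity. The second claim is the variational
  inequality of the nearest point.\<close>

lemma proj_properties:
  fixes K :: "'a::real_inner set"
  assumes "compact K" "convex K" "K \<noteq> {}"
  shows "proj K a \<in> K" "w \<in> K \<Longrightarrow> (a - proj K a) \<bullet> (w - proj K a) \<le> 0"
proof -
  have "continuous_on K (\<lambda>w. dist a w)" by (intro continuous_intros)
  then obtain y where y: "y \<in> K" "\<forall>w\<in>K. dist a y \<le> dist a w"
    using continuous_attains_inf[OF assms(1,3)] by blast
  have cl: "closed K" using assms(1) by (rule compact_imp_closed)
  have "proj K a = y"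
    unfolding proj_def
    by (rule the_equality) (use y any_closest_point_unique[OF assms(2) cl] in blast)+
  then show "proj K a \<in> K" "w \<in> K \<Longrightarrow> (a - proj K a) \<bullet> (w - proj K a) \<le> 0"
    using y any_closest_point_dot[OF assms(2) cl] by auto
qed

section \<open>Scalar differential inequalities\<close>

text \<open>Integrating the constant extension from \<open>a - 1\<close> makes the derivative at \<open>a\<close> two-sided.\<close>
definition primitive :: "real \<Rightarrow> (real \<Rightarrow> real) \<Rightarrow> real \<Rightarrow> real" where
  "primitive a g t = integral {a - 1..t} (\<lambda>s. g (max a s)) - integral {a - 1..a} (\<lambda>s. g (max a s))"

lemma primitive_start [simp]: "primitive a g a = 0"
  by (simp add: primitive_def)

lemma primitive_deriv:
  assumes "continuous_on {a..} g" and "a \<le> t"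
  shows "(primitive a g has_real_derivative g t) (at t)"
proof -
  have "continuous_on {a - 1..t + 1} (\<lambda>s. g (max a s))"
    by (rule continuous_on_compose2[OF assms(1)]) (auto intro!: continuous_intros)
  then have "((\<lambda>t. integral {a - 1..t} (\<lambda>s. g (max a s))) has_real_derivative g (max a t))
      (at t within {a - 1..t + 1})"
    by (rule integral_has_real_derivative) (use assms(2) in auto)
  moreover have "at t within {a - 1..t + 1} = at t"
    by (rule at_within_interior) (use assms(2) in auto)
  ultimately have "((\<lambda>t. integral {a - 1..t} (\<lambda>s. g (max a s))) has_real_derivative g t) (at t)"
    using assms(2) by (simp add: max_def)
  from DERIV_diff[OF this DERIV_const] show ?thesis
    by (simp add: primitive_def[abs_def])
qed

lemma nondecreasing_from_deriv:
  fixes G :: "real \<Rightarrow> real"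
  assumes "\<And>r. s \<le> r \<Longrightarrow> r \<le> t \<Longrightarrow> (G has_real_derivative G' r) (at r)"
    and "\<And>r. s \<le> r \<Longrightarrow> r \<le> t \<Longrightarrow> 0 \<le> G' r" and "s \<le> t"
  shows "G s \<le> G t"
  using assms by (intro DERIV_nonneg_imp_nondecreasing[of s t G]) blast+

lemma antimono_bounded_below_convergent:
  fixes g :: "real \<Rightarrow> real"
  assumes anti: "\<And>s t. a \<le> s \<Longrightarrow> s \<le> t \<Longrightarrow> g t \<le> g s" and low: "\<And>t. a \<le> t \<Longrightarrow> B \<le> g t"
  obtains l where "(g \<longlongrightarrow> l) at_top" "\<And>t. a \<le> t \<Longrightarrow> l \<le> g t"
proof -
  define l where "l = Inf (g ` {a..})"
  have bdd: "bdd_below (g ` {a..})" using low by (auto simp: bdd_below_def)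
  have le: "l \<le> g t" if "a \<le> t" for t
    unfolding l_def using bdd that by (auto intro: cInf_lower)
  have "(g \<longlongrightarrow> l) at_top"
  proof (rule order_tendstoI)
    fix c assume "c < l"
    show "\<forall>\<^sub>F t in at_top. c < g t"
      using eventually_ge_at_top[of a] by eventually_elim (use le \<open>c < l\<close> in force)
  next
    fix c assume "l < c"
    then obtain s where s: "a \<le> s" "g s < c"
      using cInf_lessD[of "g ` {a..}" c] by (auto simp: l_def)
    show "\<forall>\<^sub>F t in at_top. g t < c"
      using eventually_ge_at_top[of s] by eventually_elim (use anti s in force)
  qed
  then show ?thesis using le that by blast
qed

section \<open>Differential inequalities on a half-line\<close>

text \<open>The contradiction in which two later arguments end: integrating a multiple of
  \<open>1 / t\<close> would keep \<open>ln t\<close> bounded.\<close>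

lemma ln_not_bounded_above:
  assumes "\<And>t. b \<le> t \<Longrightarrow> ln t \<le> (c::real)"
  shows False
proof -
  have "\<forall>\<^sub>F t in at_top. c < ln (t::real)"
    using ln_at_top unfolding filterlim_at_top_dense by blast
  then have "\<forall>\<^sub>F t::real in at_top. False"
    using eventually_ge_at_top[of b] by eventually_elim (use assms in force)
  then show False by simp
qed

text \<open>A positive solution of \<open>J\<^sup>2 \<le> K t J'\<close> blows up in finite time, as \<open>-1/J - ln t / K\<close> increases.\<close>
lemma quadratic_growth_nonpos:
  fixes J J' :: "real \<Rightarrow> real"
  assumes b: "b > 0" and K: "K > 0"
    and deriv: "\<And>t. b \<le> t \<Longrightarrow> (J has_real_derivative J' t) (at t)"
    and nonneg: "\<And>t. b \<le> t \<Longrightarrow> 0 \<le> J' t"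
    and quad: "\<And>t. b \<le> t \<Longrightarrow> J t > 0 \<Longrightarrow> (J t)\<^sup>2 \<le> K * t * J' t"
    and s: "b \<le> s"
  shows "J s \<le> 0"
proof (rule ccontr)
  assume "\<not> J s \<le> 0"
  \<comment> \<open>\<open>J\<close> is nondecreasing, so positivity at \<open>s\<close> persists
    and \<open>1 / J\<close> makes sense from there on.\<close>
  then have pos: "J t > 0" if "s \<le> t" for t
    using nondecreasing_from_deriv[of s t J J'] deriv nonneg s that by fastforce
  define G where "G = (\<lambda>t. - inverse (J t) - ln t / K)"
  have mono: "G s \<le> G t" if "s \<le> t" for t
  proof (rule nondecreasing_from_deriv[OF _ _ that])
    fix r assume r: "s \<le> r"
    have "J r > 0" "r > 0" using pos r b s by auto
    then show "(G has_real_derivative J' r / (J r)\<^sup>2 - inverse r / K) (at r)"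
      unfolding G_def using deriv[of r] r s K
      by (auto intro!: derivative_eq_intros simp: field_simps power2_eq_square)
    show "0 \<le> J' r / (J r)\<^sup>2 - inverse r / K"
      using quad[of r] r s \<open>J r > 0\<close> \<open>r > 0\<close> K by (simp add: field_simps)
  qed
  have "ln t \<le> - K * G s" if "s \<le> t" for t
  proof -
    have "G t = - inverse (J t) - ln t / K" "inverse (J t) > 0"
      using pos[OF that] by (simp_all add: G_def)
    then have "ln t / K \<le> - G s" using mono[OF that] by linarith
    then show ?thesis using K by (simp add: field_simps)
  qed
  then show False by (rule ln_not_bounded_above)
qed

lemma powr_tendsto_at_top:
  assumes "c > (0::real)"
  shows "LIM t at_top. t powr c :> at_top"
proof -
  have "LIM t at_top. exp (c * ln (t::real)) :> at_top"
    by (intro filterlim_compose[OF exp_at_top] filterlim_tendsto_pos_mult_at_top[OF tendsto_const]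
        assms ln_at_top)
  moreover have "\<forall>\<^sub>F t in at_top. exp (c * ln (t::real)) = t powr c"
    using eventually_gt_at_top[of 0] by eventually_elim (simp add: powr_def)
  ultimately show ?thesis by (rule filterlim_cong[OF refl refl, THEN iffD1, rotated])
qed

text \<open>\<open>h = (m h) / m\<close> with \<open>m = exp (\<alpha> t\<^bsup>1-q\<^esup> / (1-q))\<close>, and \<open>(m h)' / m' = h + t\<^bsup>q\<^esup> h' / \<alpha>\<close>.\<close>
lemma tendsto_from_first_order_filter:
  fixes h h' :: "real \<Rightarrow> real"
  assumes "\<alpha> > 0" "q < 1"
    and deriv: "\<And>t. a \<le> t \<Longrightarrow> (h has_real_derivative h' t) (at t)"
    and lim: "((\<lambda>t. h t + t powr q / \<alpha> * h' t) \<longlongrightarrow> l) at_top"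
  shows "(h \<longlongrightarrow> l) at_top"
proof -
  define m where "m = (\<lambda>t::real. exp (\<alpha> / (1 - q) * t powr (1 - q)))"
  have m': "(m has_real_derivative \<alpha> * t powr (-q) * m t) (at t)" if "t > 0" for t
    unfolding m_def using that \<open>q < 1\<close> by (auto intro!: derivative_eq_intros)
  have ev: "\<forall>\<^sub>F t::real in at_top. t \<ge> a \<and> t > 0"
    using eventually_ge_at_top[of a] eventually_gt_at_top[of 0] by eventually_elim simp
  have "((\<lambda>t. m t * h t / m t) \<longlongrightarrow> l) at_top"
  \<comment> \<open>This form of l'Hospital's rule asks only the denominator \<open>m\<close> to
    tend to infinity, so nothing has to be known beforehand about the growth of
    \<open>h\<close>.\<close>
  proof (rule lhospital_at_top_at_top)
    show "LIM t at_top. m t :> at_top"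
      unfolding m_def using assms(1,2)
      by (intro filterlim_compose[OF exp_at_top] filterlim_tendsto_pos_mult_at_top[OF tendsto_const]
          powr_tendsto_at_top) auto
    show "\<forall>\<^sub>F t in at_top. \<alpha> * t powr (-q) * m t \<noteq> 0"
      using ev by eventually_elim (use \<open>\<alpha> > 0\<close> in \<open>auto simp: m_def\<close>)
    show "\<forall>\<^sub>F t in at_top. ((\<lambda>t. m t * h t) has_real_derivative
        \<alpha> * t powr (-q) * m t * h t + m t * h' t) (at t)"
      using ev by eventually_elim (auto intro!: derivative_eq_intros deriv m')
    show "\<forall>\<^sub>F t in at_top. (m has_real_derivative \<alpha> * t powr (-q) * m t) (at t)"
      using ev by eventually_elim (rule m', simp)
    have "\<forall>\<^sub>F t in at_top. h t + t powr q / \<alpha> * h' t =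
        (\<alpha> * t powr (-q) * m t * h t + m t * h' t) / (\<alpha> * t powr (-q) * m t)"
      using ev
    proof eventually_elim
      case (elim t)
      have "m t > 0" by (simp add: m_def)
      then show ?case using \<open>\<alpha> > 0\<close> elim by (simp add: powr_minus field_simps)
    qed
    from Lim_transform_eventually[OF lim this]
    show "((\<lambda>t. (\<alpha> * t powr (-q) * m t * h t + m t * h' t) / (\<alpha> * t powr (-q) * m t)) \<longlongrightarrow> l) at_top" .
  qed
  then show ?thesis by (simp add: m_def)
qed

text \<open>As \<open>h\<close> is nonnegative, the bound forces
  \<open>h' t \<le> - \<alpha> * t powr (-q)\<close>, which is at most \<open>- \<alpha> / t\<close>
  for \<open>t \<ge> 1\<close>. Hence \<open>h + \<alpha> * ln\<close> is nonincreasing, which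
  contradicts \<open>h \<ge> 0\<close>.\<close>

lemma first_order_filter_not_below:
  fixes h h' :: "real \<Rightarrow> real"
  assumes "\<alpha> > 0" "q < 1" "1 \<le> b"
    and deriv: "\<And>t. b \<le> t \<Longrightarrow> (h has_real_derivative h' t) (at t)"
    and nonneg: "\<And>t. b \<le> t \<Longrightarrow> 0 \<le> h t"
    and below: "\<And>t. b \<le> t \<Longrightarrow> h t + t powr q / \<alpha> * h' t \<le> -1"
  shows False
proof -
  have le: "\<alpha> / t \<le> - h' t" if "b \<le> t" for t
  proof -
    have t: "1 \<le> t" using that assms(3) by simp
    have "t powr q / \<alpha> * h' t \<le> -1" using below[OF that] nonneg[OF that] by simp
    then have *: "\<alpha> \<le> t powr q * (- h' t)" using \<open>\<alpha> > 0\<close> by (simp add: field_simps)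
    have "- h' t \<ge> 0"
      using * \<open>\<alpha> > 0\<close> t by (smt (verit) mult_nonneg_nonpos powr_ge_zero)
    moreover have "t powr q \<le> t powr 1" using t \<open>q < 1\<close> by (intro powr_mono) auto
    ultimately have "\<alpha> \<le> t * (- h' t)"
      using * t by (smt (verit) mult_right_mono powr_one)
    then show ?thesis using t by (simp add: field_simps)
  qed
  have "- h b - \<alpha> * ln b \<le> - h t - \<alpha> * ln t" if "b \<le> t" for t
  proof (rule nondecreasing_from_deriv[OF _ _ that])
    fix r assume "b \<le> r"
    then show "((\<lambda>t. - h t - \<alpha> * ln t) has_real_derivative - h' r - \<alpha> / r) (at r)"
      using deriv[of r] assms(3) by (auto intro!: derivative_eq_intros)
    show "0 \<le> - h' r - \<alpha> / r" using le[OF \<open>b \<le> r\<close>] by simp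
  qed
  then have "ln t \<le> (h b + \<alpha> * ln b) / \<alpha>" if "b \<le> t" for t
    using nonneg[OF that] that \<open>\<alpha> > 0\<close> by (force simp: field_simps)
  then show False by (rule ln_not_bounded_above)
qed

text \<open>Young's inequality, weighted so that the quadratic part is a quarter of the friction
  term \<open>\<alpha> * t powr q * u\<^sup>2\<close>. The freedom in \<open>r\<close> allows the
  exponent \<open>q - p\<close>, as \<open>p \<le> 2\<close>.\<close>

lemma young_powr:
  fixes t q r k u \<alpha> :: real
  assumes t: "1 \<le> t" and \<alpha>: "\<alpha> > 0" and r: "q - 2 \<le> r"
  shows "k * t powr (q - 1) * u \<le> \<alpha> / 4 * t powr q * u\<^sup>2 + k\<^sup>2 / \<alpha> * t powr r"
proof -
  define s where "s = t powr (q - 1)"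
  have pos: "t > 0" "s > 0" using t by (auto simp: s_def)
  have s: "t powr q = s * t" "t powr (q - 2) = s / t"
    using t powr_diff[of t q 1] powr_diff[of t q 2] by (auto simp: s_def power2_eq_square)
  \<comment> \<open>The shift \<open>2 * k / (\<alpha> * t)\<close> makes the cross term of the
    square equal to \<open>k * s * u\<close>.\<close>
  have "0 \<le> \<alpha> / 4 * (s * t) * (u - 2 * k / (\<alpha> * t))\<^sup>2" using \<alpha> pos by simp
  also have "\<dots> = \<alpha> / 4 * (s * t) * u\<^sup>2 - k * s * u + k\<^sup>2 / \<alpha> * (s / t)"
    using \<alpha> pos by (simp add: power2_eq_square field_simps)
  finally have "k * s * u \<le> \<alpha> / 4 * t powr q * u\<^sup>2 + k\<^sup>2 / \<alpha> * t powr (q - 2)"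
    unfolding s by simp
  also have "k\<^sup>2 / \<alpha> * t powr (q - 2) \<le> k\<^sup>2 / \<alpha> * t powr r"
    using \<alpha> t r by (intro mult_left_mono powr_mono) auto
  finally show ?thesis by (simp add: s_def)
qed

section \<open>Energy estimates for bounded trajectories\<close>

lemma has_real_derivative_inner:
  fixes u v :: "real \<Rightarrow> 'a::real_inner"
  assumes "(u has_vector_derivative u') (at t)" and "(v has_vector_derivative v') (at t)"
  shows "((\<lambda>t. u t \<bullet> v t) has_real_derivative u' \<bullet> v t + u t \<bullet> v') (at t)"
  unfolding has_field_derivative_def
  using has_derivative_inner[OF assms[unfolded has_vector_derivative_def]]
  by (rule has_derivative_eq_rhs) (auto simp: algebra_simps)

section \<open>The tail of a bounded trajectory and its regularity\<close>

text \<open>The projection equation enters through two consequences: \<open>dissipation\<close>, an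
  energy inequality valid for every index, and \<open>inclusion\<close>, which expresses the
  acceleration by one convex combination of gradients. From \<open>a \<ge> 1\<close> on,
  \<open>t powr r\<close> is monotone in \<open>r\<close>, so exponents can be compared.\<close>

locale mtrigs_tail =
  fixes f :: "'m::finite \<Rightarrow> 'a::{real_inner,complete_space} \<Rightarrow> real"
    and df :: "'m \<Rightarrow> 'a \<Rightarrow> 'a"
    and \<alpha> \<beta> q p a M :: real and x xd xdd :: "real \<Rightarrow> 'a"
  assumes grad_ineq: "\<And>i y z. f i y + df i y \<bullet> (z - y) \<le> f i z"
    and f_deriv: "\<And>i y. (f i has_derivative (\<lambda>h. df i y \<bullet> h)) (at y)"
    and lip: "\<And>i. \<exists>L. \<forall>y z. norm (df i y - df i z) \<le> L * norm (y - z)"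
    and \<alpha>: "\<alpha> > 0" and \<beta>: "\<beta> > 0" and q: "0 < q" and pq: "q + 1 < p" and p: "p \<le> 2"
    and a: "1 \<le> a"
    and x_deriv: "\<And>t. a \<le> t \<Longrightarrow> (x has_vector_derivative xd t) (at t)"
    and xd_cont: "continuous_on {a..} xd"
    and xd_ac: "\<And>T. abs_cont_on {a..T} xd"
    and xd_deriv: "AE t in lebesgue. a \<le> t \<longrightarrow> (xd has_vector_derivative xdd t) (at t)"
    and dissipation: "AE t in lebesgue. a \<le> t \<longrightarrow> (\<forall>i. xd t \<bullet> xdd t \<le>
        - (df i (x t) \<bullet> xd t) - \<beta> * t powr (-p) * (x t \<bullet> xd t) - \<alpha> * t powr (-q) * (norm (xd t))\<^sup>2)"
    and inclusion: "AE t in lebesgue. a \<le> t \<longrightarrow> (\<exists>c\<in>convex hull (range (\<lambda>i. df i (x t))).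
        xdd t = - (\<alpha> * t powr (-q)) *\<^sub>R xd t - (\<beta> * t powr (-p)) *\<^sub>R x t - c)"
    and bounded: "\<And>t. a \<le> t \<Longrightarrow> norm (x t) \<le> M"
begin

lemma q1: "q < 1"
  using pq p by simp

lemma M0: "0 \<le> M"
  using bounded[of a] norm_ge_zero[of "x a"] by linarith

lemma x_cont: "continuous_on {a..} x"
  by (intro continuous_at_imp_continuous_on ballI)
    (auto intro: has_vector_derivative_continuous[OF x_deriv])

lemma df_continuous: "continuous_on UNIV (df i)"
proof -
  obtain L where L: "\<And>y z. norm (df i y - df i z) \<le> L * norm (y - z)" using lip by blast
  have "norm (df i y - df i z) \<le> \<bar>L\<bar> * norm (y - z)" for y z
    using L[of y z] by (smt (verit) mult_right_mono norm_ge_zero)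
  then have "\<bar>L\<bar>-lipschitz_on UNIV (df i)"
    by (intro lipschitz_onI) (auto simp: dist_norm)
  then show ?thesis by (rule lipschitz_on_continuous_on)
qed

lemma df_cont: "continuous_on {a..} (\<lambda>t. df i (x t))"
  by (rule continuous_on_compose2[OF df_continuous x_cont]) auto

lemma df_bounded: obtains G where "\<And>t. a \<le> t \<Longrightarrow> norm (df i (x t)) \<le> G"
proof -
  obtain L where L: "\<And>y z. norm (df i y - df i z) \<le> L * norm (y - z)" using lip by blast
  have "norm (df i (x t)) \<le> norm (df i 0) + \<bar>L\<bar> * M" if "a \<le> t" for t
  proof -
    have "norm (df i (x t)) \<le> norm (df i 0) + norm (df i (x t) - df i 0)"
      using norm_triangle_sub by blast
    also have "norm (df i (x t) - df i 0) \<le> \<bar>L\<bar> * norm (x t)"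
      using L[of "x t" 0] by (smt (verit) diff_zero mult_right_mono norm_ge_zero)
    also have "\<dots> \<le> \<bar>L\<bar> * M" using bounded[OF that] by (simp add: mult_left_mono)
    finally show ?thesis by simp
  qed
  then show ?thesis using that by blast
qed

lemma powr_cont: "continuous_on {a..} (\<lambda>t. t powr r)"
  using a by (auto intro!: continuous_intros)

lemma f_x_deriv:
  assumes "a \<le> t"
  shows "((\<lambda>t. f i (x t)) has_real_derivative df i (x t) \<bullet> xd t) (at t)"
proof -
  have "((\<lambda>t. f i (x t)) has_derivative (\<lambda>h. df i (x t) \<bullet> (h *\<^sub>R xd t))) (at t)"
    using has_derivative_compose[OF x_deriv[OF assms, unfolded has_vector_derivative_def] f_deriv] .
  then show ?thesis by (simp add: has_field_derivative_def mult.commute[of _ "df i (x t) \<bullet> xd t"])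
qed

lemma dist_deriv:
  assumes "a \<le> t"
  shows "((\<lambda>t. (norm (x t - z))\<^sup>2 / 2) has_real_derivative (x t - z) \<bullet> xd t) (at t)"
proof -
  have "((\<lambda>t. x t - z) has_vector_derivative xd t) (at t)"
    using has_vector_derivative_diff[OF x_deriv[OF assms] has_vector_derivative_const] by simp
  from has_real_derivative_inner[OF this this]
  have "((\<lambda>t. (x t - z) \<bullet> (x t - z)) has_real_derivative 2 * ((x t - z) \<bullet> xd t)) (at t)"
    by (rule DERIV_cong) (simp add: inner_commute)
  from DERIV_cdivide[OF this, of 2] show ?thesis
    by (simp add: power2_norm_eq_inner)
qed

lemma norm_deriv:
  assumes "a \<le> t"
  shows "((\<lambda>t. (norm (x t))\<^sup>2) has_real_derivative 2 * (x t \<bullet> xd t)) (at t)"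
  using DERIV_cmult[OF dist_deriv[OF assms, of 0], of 2] by simp

lemma dist_times_speed: "\<bar>(x t - z) \<bullet> xd t\<bar> \<le> (M + norm z) * norm (xd t)" if "a \<le> t"
proof -
  have "\<bar>(x t - z) \<bullet> xd t\<bar> \<le> norm (x t - z) * norm (xd t)" by (rule Cauchy_Schwarz_ineq2)
  also have "norm (x t - z) \<le> M + norm z"
    using norm_triangle_ineq4[of "x t" z] bounded[OF that] by linarith
  finally show ?thesis by (simp add: mult_right_mono)
qed

lemma kinetic_deriv:
  "AE t in lebesgue. a \<le> t \<longrightarrow> ((\<lambda>t. (norm (xd t))\<^sup>2 / 2) has_real_derivative xd t \<bullet> xdd t) (at t)"
  using xd_deriv
proof eventually_elim
  case (elim t)
  show ?case
  proof
    assume "a \<le> t"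
    then have "(xd has_vector_derivative xdd t) (at t)" using elim by simp
    from has_real_derivative_inner[OF this this]
    have "((\<lambda>t. xd t \<bullet> xd t) has_real_derivative 2 * (xd t \<bullet> xdd t)) (at t)"
      by (rule DERIV_cong) (simp add: inner_commute)
    from DERIV_cdivide[OF this, of 2]
    show "((\<lambda>t. (norm (xd t))\<^sup>2 / 2) has_real_derivative xd t \<bullet> xdd t) (at t)"
      by (simp add: power2_norm_eq_inner)
  qed
qed

lemma kinetic_ac: "abs_cont_on {a..T} (\<lambda>t. (norm (xd t))\<^sup>2 / 2)"
proof (rule abs_cont_on_dominated)
  show "abs_cont_on {a..T} (\<lambda>t. xd t \<bullet> xd t)" by (intro abs_cont_on_inner xd_ac)
  then show "abs_cont_on {a..T} (\<lambda>t. xd t \<bullet> xd t)" .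
  \<comment> \<open>The same control function is used twice, so \<open>1 / 4\<close> stands for the
    factor \<open>1 / 2\<close>.\<close>
  show "norm ((norm (xd v))\<^sup>2 / 2 - (norm (xd u))\<^sup>2 / 2)
      \<le> 1 / 4 * (norm (xd v \<bullet> xd v - xd u \<bullet> xd u) + norm (xd v \<bullet> xd v - xd u \<bullet> xd u))" for u v
    by (simp add: power2_norm_eq_inner abs_if field_simps)
qed

section \<open>Energies, dissipation and their limits\<close>

definition D where "D = primitive a (\<lambda>t. \<alpha> * t powr (-q) * (norm (xd t))\<^sup>2)"
text \<open>The weight is that of \<open>D\<close> times \<open>t powr (2 * q)\<close>:
  differentiating \<open>t powr (2 * q) * (Dinf - D t)\<close> produces exactly
  \<open>- \<alpha>\<close> times the integrand of \<open>I\<close>.\<close>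

definition I where "I = primitive a (\<lambda>t. t powr q * (norm (xd t))\<^sup>2)"
definition W where
  "W i t = f i (x t) + (norm (xd t))\<^sup>2 / 2 + \<beta> / 2 * t powr (-p) * (norm (x t))\<^sup>2"

lemma D_deriv: "a \<le> t \<Longrightarrow> (D has_real_derivative \<alpha> * t powr (-q) * (norm (xd t))\<^sup>2) (at t)"
  unfolding D_def by (rule primitive_deriv) (intro continuous_intros powr_cont xd_cont)

lemma I_deriv: "a \<le> t \<Longrightarrow> (I has_real_derivative t powr q * (norm (xd t))\<^sup>2) (at t)"
  unfolding I_def by (rule primitive_deriv) (intro continuous_intros powr_cont xd_cont)

lemma D_mono: "a \<le> s \<Longrightarrow> s \<le> t \<Longrightarrow> D s \<le> D t"
  by (rule nondecreasing_from_deriv[where G' = "\<lambda>t. \<alpha> * t powr (-q) * (norm (xd t))\<^sup>2"])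
    (use D_deriv \<alpha> in auto)

lemma I_mono: "a \<le> s \<Longrightarrow> s \<le> t \<Longrightarrow> I s \<le> I t"
  by (rule nondecreasing_from_deriv[where G' = "\<lambda>t. t powr q * (norm (xd t))\<^sup>2"])
    (use I_deriv in auto)

lemma D_nonneg: "a \<le> t \<Longrightarrow> 0 \<le> D t"
  using D_mono[of a t] by (simp add: D_def)

text \<open>The chain rule terms of \<open>f i (x t)\<close> and of the \<open>\<beta>\<close> term
  cancel against \<open>dissipation\<close>. Only the kinetic energy is merely absolutely
  continuous; all other terms are put into the explicit antiderivative
  \<open>\<Psi>\<close>.\<close>

lemma energy_decreasing:
  assumes "a \<le> s" "s \<le> t"
  shows "W i t + D t \<le> W i s + D s"
proof -
  define \<psi> where "\<psi> = (\<lambda>t. - (df i (x t) \<bullet> xd t) + \<beta> / 2 * (p * t powr (-p-1) * (norm (x t))\<^sup>2)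
      - \<beta> * t powr (-p) * (x t \<bullet> xd t) - \<alpha> * t powr (-q) * (norm (xd t))\<^sup>2)"
  define \<Psi> where "\<Psi> = (\<lambda>t. - f i (x t) - \<beta> / 2 * (t powr (-p) * (norm (x t))\<^sup>2) - D t)"
  have "(norm (xd t))\<^sup>2 / 2 - \<Psi> t \<le> (norm (xd s))\<^sup>2 / 2 - \<Psi> s"
  proof (rule abs_cont_on_diff_antimono[OF kinetic_ac _ _ _ assms])
    show "(\<Psi> has_real_derivative \<psi> t) (at t)" if "a \<le> t" for t
    proof -
      have "((\<lambda>t. t powr (-p)) has_real_derivative - p * t powr (-p-1)) (at t)"
        using that a by (intro has_real_derivative_powr) auto
      from DERIV_mult[OF this norm_deriv[OF that]]
      have "((\<lambda>t. t powr (-p) * (norm (x t))\<^sup>2) has_real_derivative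
          - p * t powr (-p-1) * (norm (x t))\<^sup>2 + 2 * (x t \<bullet> xd t) * t powr (-p)) (at t)" .
      from DERIV_diff[OF DERIV_diff[OF DERIV_minus[OF f_x_deriv[OF that, of i]]
          DERIV_cmult[OF this, of "\<beta> / 2"]] D_deriv[OF that]]
      show ?thesis unfolding \<Psi>_def
        by (rule DERIV_cong) (simp add: \<psi>_def algebra_simps)
    qed
    show "continuous_on {a..} \<psi>"
      unfolding \<psi>_def by (intro continuous_intros df_cont xd_cont x_cont powr_cont)
    show "AE t in lebesgue. a \<le> t \<longrightarrow>
        (\<exists>D\<le>\<psi> t. ((\<lambda>t. (norm (xd t))\<^sup>2 / 2) has_real_derivative D) (at t))"
      using kinetic_deriv dissipation
    proof eventually_elim
      case (elim t)
      \<comment> \<open>The term from differentiating the decreasing coefficient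
        \<open>t powr (-p)\<close> has the favourable sign.\<close>
      have "0 \<le> \<beta> / 2 * (p * t powr (-p-1) * (norm (x t))\<^sup>2)"
        using \<beta> pq q by (intro mult_nonneg_nonneg) auto
      then show ?case using elim unfolding \<psi>_def by (smt (verit))
    qed
  qed
  then show ?thesis by (simp add: \<Psi>_def W_def algebra_simps)
qed

text \<open>The tangent plane at the origin lies below the convex function and is bounded below on
  the trajectory.\<close>

lemma f_lower: obtains B where "\<And>t. a \<le> t \<Longrightarrow> B \<le> f i (x t)"
proof -
  have "f i 0 - norm (df i 0) * M \<le> f i (x t)" if "a \<le> t" for t
  proof -
    have "\<bar>df i 0 \<bullet> x t\<bar> \<le> norm (df i 0) * norm (x t)" by (rule Cauchy_Schwarz_ineq2)
    also have "\<dots> \<le> norm (df i 0) * M" using bounded[OF that] by (simp add: mult_left_mono)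
    finally show ?thesis using grad_ineq[of i 0 "x t"] by simp
  qed
  then show ?thesis using that by blast
qed

lemma f_le_W: "f i (x t) + (norm (xd t))\<^sup>2 / 2 \<le> W i t"
  using \<beta> by (simp add: W_def)

lemma speed_bounded: obtains V where "0 \<le> V" "\<And>t. a \<le> t \<Longrightarrow> norm (xd t) \<le> V"
proof -
  fix i :: 'm
  obtain B where B: "\<And>t. a \<le> t \<Longrightarrow> B \<le> f i (x t)" using f_lower by blast
  have "(norm (xd t))\<^sup>2 \<le> 2 * (W i a + D a - B)" if "a \<le> t" for t
    using energy_decreasing[of a t i] f_le_W[of i t] B[OF that] D_nonneg[OF that] that by simp
  then have "norm (xd t) \<le> sqrt (2 * (W i a + D a - B))" if "a \<le> t" for t
    using that real_le_rsqrt by blast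
  then show ?thesis using that[of "sqrt (2 * (W i a + D a - B))"]
    by (metis norm_ge_zero order_refl order_trans)
qed

text \<open>\<open>W i + D\<close> is nonincreasing and bounded below, and \<open>D\<close> is
  nondecreasing and bounded, so both converge. The last inequality says that every
  \<open>W i t - Winf i\<close> dominates the same remaining dissipation
  \<open>Dinf - D t\<close>.\<close>

lemma energy_limits: obtains Winf Dinf where "\<And>i. (W i \<longlongrightarrow> Winf i) at_top"
  "\<And>t. a \<le> t \<Longrightarrow> D t \<le> Dinf" "\<And>i t. a \<le> t \<Longrightarrow> Winf i + Dinf \<le> W i t + D t"
proof -
  have WB: "\<exists>B. \<forall>t\<ge>a. B \<le> W i t" for i
  proof -
    obtain B where "\<And>t. a \<le> t \<Longrightarrow> B \<le> f i (x t)" using f_lower by blast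
    then show ?thesis using f_le_W[of i] by (meson order_trans le_add_same_cancel1 zero_le_power2
      divide_nonneg_pos zero_less_numeral)
  qed
  have "\<exists>l. ((\<lambda>t. W i t + D t) \<longlongrightarrow> l) at_top \<and> (\<forall>t\<ge>a. l \<le> W i t + D t)" for i
  proof -
    obtain B where B: "\<And>t. a \<le> t \<Longrightarrow> B \<le> W i t" using WB by blast
    show ?thesis
      by (rule antimono_bounded_below_convergent[of a "\<lambda>t. W i t + D t" B])
        (use energy_decreasing B D_nonneg in \<open>auto intro: add_increasing2\<close>)
  qed
  then obtain E where E: "\<And>i. ((\<lambda>t. W i t + D t) \<longlongrightarrow> E i) at_top"
    "\<And>i t. a \<le> t \<Longrightarrow> E i \<le> W i t + D t" by metis
  \<comment> \<open>A single index suffices to bound \<open>D\<close>.\<close>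
  fix j :: 'm
  obtain B where B: "\<And>t. a \<le> t \<Longrightarrow> B \<le> W j t" using WB by blast
  obtain l where l: "((\<lambda>t. - D t) \<longlongrightarrow> l) at_top" "\<And>t. a \<le> t \<Longrightarrow> l \<le> - D t"
  proof (rule antimono_bounded_below_convergent[of a "\<lambda>t. - D t" "B - W j a - D a"])
    show "B - W j a - D a \<le> - D t" if "a \<le> t" for t
      using energy_decreasing[of a t j] B[OF that] that by simp
  qed (use D_mono in auto)
  have "(W i \<longlongrightarrow> E i + l) at_top" for i
    using tendsto_add[OF E(1)[of i] l(1)] by simp
  then show ?thesis
    using that[of "\<lambda>i. E i + l" "- l"] l(2) E(2) by (simp add: le_minus_iff)
qed

text \<open>Every convex combination \<open>c\<close> of the gradients satisfies
  \<open>c \<bullet> (z - x) \<le> max\<^sub>i (f\<^sub>i z - f\<^sub>i x)\<close>, and the energy bound \<open>E\<^sub>i \<le> W\<^sub>i + D\<close> makes the right-hand side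
  controllable uniformly in \<open>i\<close> although the weights of \<open>c\<close> vary with time.\<close>
lemma anchor_inequality:
  assumes W: "\<And>i t. a \<le> t \<Longrightarrow> Winf i + Dinf \<le> W i t + D t"
    and z: "\<And>i. f i z + \<eta> \<le> Winf i"
  shows "AE t in lebesgue. a \<le> t \<longrightarrow> (norm (xd t))\<^sup>2 + (x t - z) \<bullet> xdd t \<le>
    - \<alpha> * t powr (-q) * ((x t - z) \<bullet> xd t) - (Dinf - D t) - \<eta> + 3 / 2 * (norm (xd t))\<^sup>2
    + \<beta> / 2 * t powr (-p) * (norm z)\<^sup>2"
  using inclusion
proof eventually_elim
  case (elim t)
  show ?case
  proof
    assume t: "a \<le> t"
    then obtain c where c: "c \<in> convex hull (range (\<lambda>i. df i (x t)))"
      and xdd: "xdd t = - (\<alpha> * t powr (-q)) *\<^sub>R xd t - (\<beta> * t powr (-p)) *\<^sub>R x t - c"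
      using elim by blast
    define b where "b = \<beta> * t powr (-p)"
    have "0 \<le> b" using \<beta> by (simp add: b_def)
    define k where "k = - \<eta> - (Dinf - D t) + (norm (xd t))\<^sup>2 / 2 + b / 2 * (norm (x t))\<^sup>2"
    have "(z - x t) \<bullet> df i (x t) \<le> k" for i
      using grad_ineq[of i "x t" z] z[of i] W[OF t, of i]
      by (simp add: W_def k_def b_def inner_commute)
    then have "convex hull (range (\<lambda>i. df i (x t))) \<subseteq> {c. (z - x t) \<bullet> c \<le> k}"
      by (intro hull_minimal convex_halfspace_le) auto
    then have ck: "(z - x t) \<bullet> c \<le> k" using c by blast
    have "(x t - z) \<bullet> xdd t = - \<alpha> * t powr (-q) * ((x t - z) \<bullet> xd t)
        - b * ((norm (x t))\<^sup>2 - z \<bullet> x t) + (z - x t) \<bullet> c"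
      unfolding xdd b_def power2_norm_eq_inner by (simp add: inner_diff algebra_simps)
    \<comment> \<open>This square turns
      \<open>b * (z \<bullet> x t) - b / 2 * (norm (x t))\<^sup>2\<close>, left over from the
      \<open>\<beta>\<close> terms, into at most \<open>b / 2 * (norm z)\<^sup>2\<close>.\<close>
    moreover have "0 \<le> b * (norm (x t - z))\<^sup>2" using \<open>0 \<le> b\<close> by simp
    then have "0 \<le> b * ((norm (x t))\<^sup>2 - 2 * (z \<bullet> x t) + (norm z)\<^sup>2)"
      by (simp add: power2_norm_eq_inner inner_diff inner_commute algebra_simps)
    ultimately have "(norm (xd t))\<^sup>2 + (x t - z) \<bullet> xdd t \<le>
      - \<alpha> * t powr (-q) * ((x t - z) \<bullet> xd t) - (Dinf - D t) - \<eta> + 3 / 2 * (norm (xd t))\<^sup>2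
      + b / 2 * (norm z)\<^sup>2"
      using ck by (simp add: k_def algebra_simps)
    then show "(norm (xd t))\<^sup>2 + (x t - z) \<bullet> xdd t \<le>
      - \<alpha> * t powr (-q) * ((x t - z) \<bullet> xd t) - (Dinf - D t) - \<eta> + 3 / 2 * (norm (xd t))\<^sup>2
      + \<beta> / 2 * t powr (-p) * (norm z)\<^sup>2"
      by (simp add: b_def)
  qed
qed

section \<open>Integrated anchor inequality and the weighted kinetic energy\<close>

text \<open>With \<open>h' = (x t - z) \<bullet> xd t\<close>, the product \<open>w * h'\<close> has
  derivative \<open>w' * h' + w * h''\<close> almost everywhere, and the anchor inequality bounds
  \<open>h''\<close>. The weight and the majorant \<open>\<psi>\<close> stay free because two
  different choices are needed below.\<close>

lemma weighted_anchor_antimono: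
  fixes w w' \<Psi> \<psi> :: "real \<Rightarrow> real"
  assumes W: "\<And>i t. a \<le> t \<Longrightarrow> Winf i + Dinf \<le> W i t + D t"
    and z: "\<And>i. f i z + \<eta> \<le> Winf i" and b: "a \<le> b"
    and w: "\<And>t. b \<le> t \<Longrightarrow> (w has_real_derivative w' t) (at t)" "\<And>t. b \<le> t \<Longrightarrow> 0 \<le> w t"
    and w'_cont: "continuous_on {b..} w'"
    and \<Psi>: "\<And>t. b \<le> t \<Longrightarrow> (\<Psi> has_real_derivative \<psi> t) (at t)" and \<psi>_cont: "continuous_on {b..} \<psi>"
    and \<psi>: "\<And>t. b \<le> t \<Longrightarrow> w' t * ((x t - z) \<bullet> xd t) + w t *
      (- \<alpha> * t powr (-q) * ((x t - z) \<bullet> xd t) - (Dinf - D t) - \<eta> + 3 / 2 * (norm (xd t))\<^sup>2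
      + \<beta> / 2 * t powr (-p) * (norm z)\<^sup>2) \<le> \<psi> t"
    and st: "b \<le> s" "s \<le> t"
  shows "w t * ((x t - z) \<bullet> xd t) - \<Psi> t \<le> w s * ((x s - z) \<bullet> xd s) - \<Psi> s"
proof -
  \<comment> \<open>Attaching the weight to the continuously differentiable factor leaves an inner
    product of two absolutely continuous functions.\<close>
  define y where "y = (\<lambda>t. w t *\<^sub>R (x t - z))"
  define y' where "y' = (\<lambda>t. w' t *\<^sub>R (x t - z) + w t *\<^sub>R xd t)"
  have y: "(y has_vector_derivative y' t) (at t)" if "b \<le> t" for t
  proof -
    have "((\<lambda>t. x t - z) has_vector_derivative xd t) (at t)"
      using has_vector_derivative_diff[OF x_deriv has_vector_derivative_const] that b by simp
    from has_vector_derivative_scaleR[OF w(1)[OF that] this] show ?thesis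
      unfolding y_def y'_def by (simp add: add.commute)
  qed
  have sub: "{b..} \<subseteq> {a..}" using b by auto
  have "continuous_on {b..} w"
    by (intro continuous_at_imp_continuous_on ballI) (auto intro: DERIV_isCont[OF w(1)])
  then have y'_cont: "continuous_on {b..} y'"
    unfolding y'_def by (intro continuous_intros w'_cont continuous_on_subset[OF x_cont sub]
      continuous_on_subset[OF xd_cont sub])
  have ac: "abs_cont_on {b..T} (\<lambda>t. y t \<bullet> xd t)" for T
  proof (rule abs_cont_on_inner)
    show "abs_cont_on {b..T} y"
    proof (rule abs_cont_on_C1)
      show "(y has_vector_derivative y' t) (at t within {b..T})" if "t \<in> {b..T}" for t
        by (rule has_vector_derivative_at_within, rule y) (use that in auto)
      show "continuous_on {b..T} y'" by (rule continuous_on_subset[OF y'_cont]) auto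
    qed
    show "abs_cont_on {b..T} xd" by (rule abs_cont_on_subset[OF xd_ac[of T]]) (use b in auto)
  qed
  have anchor: "AE t in lebesgue. a \<le> t \<longrightarrow> (norm (xd t))\<^sup>2 + (x t - z) \<bullet> xdd t \<le>
      - \<alpha> * t powr (-q) * ((x t - z) \<bullet> xd t) - (Dinf - D t) - \<eta> + 3 / 2 * (norm (xd t))\<^sup>2
      + \<beta> / 2 * t powr (-p) * (norm z)\<^sup>2"
    by (rule anchor_inequality) (use W z in auto)
  have "y t \<bullet> xd t - \<Psi> t \<le> y s \<bullet> xd s - \<Psi> s"
  proof (rule abs_cont_on_diff_antimono[OF ac \<Psi> \<psi>_cont _ st])
    show "AE t in lebesgue. b \<le> t \<longrightarrow> (\<exists>D\<le>\<psi> t. ((\<lambda>t. y t \<bullet> xd t) has_real_derivative D) (at t))"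
      using xd_deriv anchor
    proof eventually_elim
      case (elim t)
      show ?case
      proof
        assume t: "b \<le> t"
        then have "(xd has_vector_derivative xdd t) (at t)" using elim(1) b by simp
        from has_real_derivative_inner[OF y[OF t] this]
        have "((\<lambda>t. y t \<bullet> xd t) has_real_derivative
            w' t * ((x t - z) \<bullet> xd t) + w t * ((norm (xd t))\<^sup>2 + (x t - z) \<bullet> xdd t)) (at t)"
          by (rule DERIV_cong)
            (simp add: y_def y'_def inner_add power2_norm_eq_inner algebra_simps)
        moreover have "w t * ((norm (xd t))\<^sup>2 + (x t - z) \<bullet> xdd t) \<le> w t *
            (- \<alpha> * t powr (-q) * ((x t - z) \<bullet> xd t) - (Dinf - D t) - \<eta> + 3 / 2 * (norm (xd t))\<^sup>2
            + \<beta> / 2 * t powr (-p) * (norm z)\<^sup>2)"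
          using elim(2) t b w(2)[OF t] by (intro mult_left_mono) auto
        ultimately show "\<exists>D\<le>\<psi> t. ((\<lambda>t. y t \<bullet> xd t) has_real_derivative D) (at t)"
          using \<psi>[OF t] by (meson add_left_mono order_trans)
      qed
    qed
  qed auto
  then show ?thesis by (simp add: y_def)
qed

text \<open>Since \<open>1 + q - p < 0\<close>, this antiderivative is nonpositive and tends to
  \<open>0\<close>: errors of order \<open>t powr (q - p)\<close> are integrable at
  infinity.\<close>

lemma powr_antideriv:
  assumes "a \<le> t"
  shows "((\<lambda>t. t powr (1 + q - p) / (1 + q - p)) has_real_derivative t powr (q - p)) (at t)"
  using has_real_derivative_powr[of t "1 + q - p"] assms a pq
  by (auto intro!: derivative_eq_intros)

text \<open>The quantity \<open>t powr (2 * q) * (Dinf - D t) + w t * h1 t + \<alpha> / 2 * I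
  t\<close> is nonincreasing up to an integrable error: of the friction contribution
  \<open>\<alpha> * t powr q * (norm (xd t))\<^sup>2\<close> half is spent on absorbing errors and
  half feeds \<open>I\<close>. Bounding \<open>h1\<close> by the speed then gives the quadratic
  differential inequality excluded by blow-up.\<close>

lemma I_bounded:
  assumes W: "\<And>i t. a \<le> t \<Longrightarrow> Winf i + Dinf \<le> W i t + D t"
    and Dinf: "\<And>t. a \<le> t \<Longrightarrow> D t \<le> Dinf" and z: "\<And>i. f i z \<le> Winf i"
  obtains B where "\<And>t. a \<le> t \<Longrightarrow> I t \<le> B"
proof -
  \<comment> \<open>Because \<open>q < 1\<close>, the kinetic error
    \<open>3 * q * t powr (2 * q - 1) * (norm (xd t))\<^sup>2\<close> is eventually at most a
    quarter of the friction contribution.\<close>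
  have "((\<lambda>t::real. 3 * q * t powr (q - 1)) \<longlongrightarrow> 3 * q * 0) at_top"
    by (intro tendsto_mult tendsto_const tendsto_neg_powr filterlim_ident) (use q1 in simp)
  then have "\<forall>\<^sub>F t in at_top. 3 * q * t powr (q - 1) < \<alpha> / 4"
    by (rule order_tendstoD) (use \<alpha> in simp)
  then obtain b0 where b0: "\<And>t. b0 \<le> t \<Longrightarrow> 3 * q * t powr (q - 1) < \<alpha> / 4"
    unfolding eventually_at_top_linorder by blast
  define b where "b = max a b0"
  have b: "a \<le> b" and small: "\<And>t. b \<le> t \<Longrightarrow> 3 * q * t powr (q - 1) < \<alpha> / 4"
    using b0 by (auto simp: b_def)
  have b1: "1 \<le> b" using a b by simp
  \<comment> \<open>The summand \<open>1\<close> makes \<open>N\<close> strictly positive, as needed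
    for the constant in \<open>quadratic_growth_nonpos\<close>.\<close>
  define N where "N = M + norm z + 1"
  have N: "N > 0" using M0 by (simp add: N_def add_nonneg_pos)
  define h1 where "h1 = (\<lambda>t. (x t - z) \<bullet> xd t)"
  have h1: "\<bar>h1 t\<bar> \<le> N * norm (xd t)" if "b \<le> t" for t
    using dist_times_speed[of t z] that b
    by (simp add: h1_def N_def algebra_simps) (smt (verit) norm_ge_zero)
  define K where "K = 2 * q * \<bar>2 * q - 1\<bar> + 2 * q * \<alpha>"
  have K: "K \<ge> 0" using q \<alpha> by (simp add: K_def)
  \<comment> \<open>The first summand comes from Young's inequality for the terms in
    \<open>h1\<close>, the second from the \<open>\<beta>\<close> term.\<close>
  define C where "C = (K * N)\<^sup>2 / \<alpha> + q * \<beta> * (norm z)\<^sup>2"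
  have C: "C \<ge> 0" using q \<alpha> \<beta> by (simp add: C_def)
  \<comment> \<open>The factor \<open>2 * q\<close> makes the remaining dissipation in
    \<open>w * h''\<close> cancel the term from differentiating
    \<open>t powr (2 * q)\<close>.\<close>
  define w where "w = (\<lambda>t. 2 * q * t powr (2 * q - 1))"
  define \<psi> where "\<psi> = (\<lambda>t. - (2 * q * t powr (2 * q - 1) * (Dinf - D t))
      + \<alpha> / 2 * (t powr q * (norm (xd t))\<^sup>2) + C * t powr (q - p))"
  define \<Psi> where "\<Psi> = (\<lambda>t. - (t powr (2 * q) * (Dinf - D t)) - \<alpha> / 2 * I t
      + C * (t powr (1 + q - p) / (1 + q - p)))"
  have mono: "w t * h1 t - \<Psi> t \<le> w b * h1 b - \<Psi> b" if "b \<le> t" for t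
    unfolding h1_def
  proof (rule weighted_anchor_antimono[where Dinf = Dinf and \<eta> = 0 and Winf = Winf and
        w' = "\<lambda>t. 2 * q * ((2 * q - 1) * t powr (2 * q - 2))" and \<psi> = \<psi>, OF _ _ b])
    fix t assume t: "b \<le> t"
    then have t1: "1 \<le> t" "0 < t" and ta: "a \<le> t" using b1 b by auto
    show "(w has_real_derivative 2 * q * ((2 * q - 1) * t powr (2 * q - 2))) (at t)"
      unfolding w_def using has_real_derivative_powr[OF t1(2), of "2 * q - 1"]
      by (intro DERIV_cmult) simp
    show "0 \<le> w t" using q by (simp add: w_def)
    show "(\<Psi> has_real_derivative \<psi> t) (at t)"
    proof -
      have 1: "((\<lambda>t. Dinf - D t) has_real_derivative 0 - \<alpha> * t powr (-q) * (norm (xd t))\<^sup>2) (at t)"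
        by (intro DERIV_diff DERIV_const D_deriv ta)
      have "t powr (-q) * t powr (2 * q) = t powr q"
        by (simp flip: powr_add)
      then have 2: "\<alpha> * t powr (-q) * (norm (xd t))\<^sup>2 * t powr (2 * q)
          = \<alpha> * (t powr q * (norm (xd t))\<^sup>2)"
        by (metis (no_types, lifting) mult.assoc mult.commute)
      show ?thesis unfolding \<Psi>_def
        by (rule DERIV_cong[OF DERIV_add[OF DERIV_diff[OF DERIV_minus[OF DERIV_mult[OF
            has_real_derivative_powr[OF t1(2), of "2 * q"] 1]] DERIV_cmult[OF I_deriv[OF ta]]]
            DERIV_cmult[OF powr_antideriv[OF ta]]]])
          (use 2 in \<open>simp add: \<psi>_def algebra_simps\<close>)
    qed
    define u where "u = norm (xd t)"
    define s where "s = t powr (q - 1)"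
    have s: "0 < s" "s \<le> 1" using t1 q1 powr_mono[of "q - 1" 0 t] by (auto simp: s_def)
    have e1: "t powr (2 * q - 2) = s * s" and e2: "t powr (2 * q - 1) = s * t powr q"
      and e3: "t powr (2 * q - 1) * t powr (-q) = s"
      and e4: "t powr (2 * q - 1) * t powr (-p) = s * t powr (q - p)"
      unfolding s_def by (simp_all add: algebra_simps flip: powr_add)
    have hN: "\<bar>h1 t\<bar> \<le> N * u" using h1[OF t] by (simp add: u_def)
    have "2 * q * ((2 * q - 1) * (s * s)) * h1 t - 2 * q * \<alpha> * s * h1 t
        \<le> \<bar>2 * q * ((2 * q - 1) * (s * s)) * h1 t\<bar> + \<bar>2 * q * \<alpha> * s * h1 t\<bar>"
      by (simp only: abs_if split: if_splits) auto
    also have "\<dots> = (2 * q * \<bar>2 * q - 1\<bar> * s + 2 * q * \<alpha>) * (s * \<bar>h1 t\<bar>)"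
      unfolding abs_mult using q s \<alpha> by (simp add: algebra_simps)
    also have "\<dots> \<le> K * (s * (N * u))"
    proof (intro mult_mono)
      have "2 * q * \<bar>2 * q - 1\<bar> * s \<le> 2 * q * \<bar>2 * q - 1\<bar> * 1"
        using s q by (intro mult_left_mono) auto
      then show "2 * q * \<bar>2 * q - 1\<bar> * s + 2 * q * \<alpha> \<le> K" by (simp add: K_def)
    qed (use s K hN in auto)
    also have "\<dots> = (K * N) * s * u" by simp
    also have "\<dots> \<le> \<alpha> / 4 * t powr q * u\<^sup>2 + (K * N)\<^sup>2 / \<alpha> * t powr (q - p)"
      unfolding s_def by (rule young_powr[OF t1(1) \<alpha>]) (use p in simp)
    finally have A: "2 * q * ((2 * q - 1) * (s * s)) * h1 t - 2 * q * \<alpha> * s * h1 t \<le> \<dots>" .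
    have B1: "3 * q * s * (t powr q * u\<^sup>2) \<le> \<alpha> / 4 * (t powr q * u\<^sup>2)"
      using small[OF t] by (intro mult_right_mono) (auto simp: s_def)
    have B2: "q * \<beta> * (norm z)\<^sup>2 * (s * t powr (q - p)) \<le> q * \<beta> * (norm z)\<^sup>2 * (1 * t powr (q - p))"
      using s q \<beta> by (intro mult_left_mono mult_right_mono) auto
    have B: "2 * q * ((2 * q - 1) * (s * s)) * h1 t - 2 * q * \<alpha> * s * h1 t
        - 2 * q * (s * t powr q) * (Dinf - D t) + 3 * q * s * (t powr q * u\<^sup>2)
        + q * \<beta> * (norm z)\<^sup>2 * (s * t powr (q - p)) \<le> \<psi> t"
    proof -
      have "\<psi> t = - (2 * q * (s * t powr q) * (Dinf - D t)) + \<alpha> / 2 * (t powr q * u\<^sup>2)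
          + ((K * N)\<^sup>2 / \<alpha> * t powr (q - p) + q * \<beta> * (norm z)\<^sup>2 * (1 * t powr (q - p)))"
        unfolding \<psi>_def C_def e2 u_def by (simp add: distrib_right)
      moreover have "\<alpha> / 4 * t powr q * u\<^sup>2 = \<alpha> / 4 * (t powr q * u\<^sup>2)" by simp
      ultimately show ?thesis using A B1 B2 by linarith
    qed
    have "2 * q * ((2 * q - 1) * t powr (2 * q - 2)) * h1 t + w t *
      (- \<alpha> * t powr (-q) * h1 t - (Dinf - D t) - 0 + 3 / 2 * u\<^sup>2 + \<beta> / 2 * t powr (-p) * (norm z)\<^sup>2)
      = 2 * q * ((2 * q - 1) * t powr (2 * q - 2)) * h1 t
        - 2 * q * \<alpha> * (t powr (2 * q - 1) * t powr (-q)) * h1 t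
        - 2 * q * t powr (2 * q - 1) * (Dinf - D t) + 3 * q * t powr (2 * q - 1) * u\<^sup>2
        + q * \<beta> * (norm z)\<^sup>2 * (t powr (2 * q - 1) * t powr (-p))"
      by (simp add: w_def algebra_simps)
    also have "\<dots> = 2 * q * ((2 * q - 1) * (s * s)) * h1 t - 2 * q * \<alpha> * s * h1 t
        - 2 * q * (s * t powr q) * (Dinf - D t) + 3 * q * s * (t powr q * u\<^sup>2)
        + q * \<beta> * (norm z)\<^sup>2 * (s * t powr (q - p))"
      by (simp only: e3 e4 e1) (simp add: e2)
    finally show "2 * q * ((2 * q - 1) * t powr (2 * q - 2)) * ((x t - z) \<bullet> xd t) + w t *
      (- \<alpha> * t powr (-q) * ((x t - z) \<bullet> xd t) - (Dinf - D t) - 0 + 3 / 2 * (norm (xd t))\<^sup>2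
        + \<beta> / 2 * t powr (-p) * (norm z)\<^sup>2) \<le> \<psi> t"
      using B unfolding h1_def u_def by simp
  next
    have sub: "{b..} \<subseteq> {a..}" using b by auto
    have D_cont: "continuous_on {a..} D"
      by (intro continuous_at_imp_continuous_on ballI) (auto intro: DERIV_isCont[OF D_deriv])
    show "continuous_on {b..} \<psi>"
      unfolding \<psi>_def by (intro continuous_on_subset[OF _ sub] continuous_intros powr_cont D_cont xd_cont)
    show "continuous_on {b..} (\<lambda>t. 2 * q * ((2 * q - 1) * t powr (2 * q - 2)))"
      by (intro continuous_on_subset[OF _ sub] continuous_intros powr_cont)
  qed (use W z that in auto)
  define A where "A = w b * h1 b - \<Psi> b"
  \<comment> \<open>The remaining dissipation and the \<open>C\<close> term have favourable signs
    and are dropped; only the boundary term \<open>w t * h1 t\<close> is left.\<close>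
  have growth: "\<alpha> / 2 * I t - A \<le> 2 * q * N * (t powr (2 * q - 1) * norm (xd t))" if t: "b \<le> t" for t
  proof -
    have "0 \<le> t powr (2 * q) * (Dinf - D t)" using Dinf[of t] t b by simp
    moreover have "C * (t powr (1 + q - p) / (1 + q - p)) \<le> 0"
      using C pq by (intro mult_nonneg_nonpos divide_nonneg_neg) auto
    moreover have "- (w t * h1 t) \<le> w t * (N * norm (xd t))"
    proof -
      have "w t * (- h1 t) \<le> w t * (N * norm (xd t))"
        using h1[OF t] q by (intro mult_left_mono) (auto simp: w_def)
      then show ?thesis by simp
    qed
    moreover have "w t * h1 t - \<Psi> t \<le> A" using mono[OF t] by (simp add: A_def)
    moreover have "\<Psi> t = - (t powr (2 * q) * (Dinf - D t)) - \<alpha> / 2 * I t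
        + C * (t powr (1 + q - p) / (1 + q - p))" by (simp add: \<Psi>_def)
    ultimately have "\<alpha> / 2 * I t - A \<le> w t * (N * norm (xd t))" by linarith
    then show ?thesis by (simp add: w_def mult_ac)
  qed
  have "\<alpha> / 2 * I t - A \<le> 0" if "b \<le> t" for t
  proof (rule quadratic_growth_nonpos[where J = "\<lambda>t. \<alpha> / 2 * I t - A" and s = t and b = b and K = "(2 * q * N)\<^sup>2 * 2 / \<alpha>"
        and J' = "\<lambda>t. \<alpha> / 2 * (t powr q * (norm (xd t))\<^sup>2)"])
    show "0 < (2 * q * N)\<^sup>2 * 2 / \<alpha>" using q N \<alpha> by simp
    fix t assume t: "b \<le> t"
    have t1: "1 \<le> t" using t b1 by simp
    show "((\<lambda>t. \<alpha> / 2 * I t - A) has_real_derivative \<alpha> / 2 * (t powr q * (norm (xd t))\<^sup>2)) (at t)"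
      using DERIV_diff[OF DERIV_cmult[OF I_deriv, of t "\<alpha>/2"] DERIV_const, of A] t b by simp
    show "0 \<le> \<alpha> / 2 * (t powr q * (norm (xd t))\<^sup>2)" using \<alpha> by simp
    assume "\<alpha> / 2 * I t - A > 0"
    then have "(\<alpha> / 2 * I t - A)\<^sup>2 \<le> (2 * q * N * (t powr (2 * q - 1) * norm (xd t)))\<^sup>2"
      using growth[OF t] by (intro power_mono) auto
    also have "\<dots> = (2 * q * N)\<^sup>2 * (t powr (2 * (2 * q - 1)) * (norm (xd t))\<^sup>2)"
      by (simp add: power_mult_distrib power2_eq_square flip: powr_add)
    \<comment> \<open>The exponents compare because \<open>2 * (2 * q - 1) \<le> 1 + q\<close>
      amounts to \<open>q \<le> 1\<close>. The extra factor \<open>t\<close> is the one in the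
      blow-up lemma.\<close>
    also have "\<dots> \<le> (2 * q * N)\<^sup>2 * (t powr (1 + q) * (norm (xd t))\<^sup>2)"
      using t1 q1 by (intro mult_left_mono mult_right_mono powr_mono) auto
    also have "\<dots> = (2 * q * N)\<^sup>2 * 2 / \<alpha> * t * (\<alpha> / 2 * (t powr q * (norm (xd t))\<^sup>2))"
      using t1 \<alpha> by (simp add: powr_add)
    finally show "(\<alpha> / 2 * I t - A)\<^sup>2 \<le> \<dots>" .
  qed (use b1 that in auto)
  then have "I t \<le> 2 * A / \<alpha>" if "b \<le> t" for t
    using that \<alpha> by (simp add: field_simps)
  moreover have "I t \<le> 2 * A / \<alpha>" if "a \<le> t" "t \<le> b" for t
    using I_mono[of t b] calculation[of b] that by simp
  ultimately show ?thesis using that by (metis linear)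
qed

section \<open>Weak cluster points and decay of the speed\<close>

text \<open>Weak lower semicontinuity through the tangent plane at \<open>z\<close>, which is weakly
  continuous and lies below \<open>f i\<close>. The comparison is with \<open>W i\<close>, whose
  limit is known before that of \<open>f i (x t)\<close>.\<close>

lemma weak_cluster_le:
  assumes Winf: "(W i \<longlongrightarrow> Winf i) at_top"
    and G: "G \<noteq> bot" "G \<le> at_top" "\<And>u. ((\<lambda>t. x t \<bullet> u) \<longlongrightarrow> z \<bullet> u) G"
  shows "f i z \<le> Winf i"
proof (rule tendsto_le[OF G(1)])
  show "(W i \<longlongrightarrow> Winf i) G" using Winf G(2) by (rule tendsto_mono[rotated])
  show "((\<lambda>t. f i z + (x t \<bullet> df i z - z \<bullet> df i z)) \<longlongrightarrow> f i z) G"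
    using tendsto_add[OF tendsto_const tendsto_diff[OF G(3)[of "df i z"] tendsto_const],
        of "f i z" "z \<bullet> df i z"] by simp
  have "f i z + (x t \<bullet> df i z - z \<bullet> df i z) \<le> W i t" for t
  proof -
    have "f i z + (x t \<bullet> df i z - z \<bullet> df i z) \<le> f i (x t)"
      using grad_ineq[of i z "x t"] by (simp add: inner_diff_right inner_commute)
    moreover have "0 \<le> (norm (xd t))\<^sup>2 / 2" by simp
    ultimately show ?thesis using f_le_W[of i t] by linarith
  qed
  then show "\<forall>\<^sub>F t in G. f i z + (x t \<bullet> df i z - z \<bullet> df i z) \<le> W i t" by simp
qed

lemma I_convergent:
  assumes B: "\<And>t. a \<le> t \<Longrightarrow> I t \<le> B"
  obtains Iinf where "(I \<longlongrightarrow> Iinf) at_top"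
proof -
  obtain l where "((\<lambda>t. - I t) \<longlongrightarrow> l) at_top"
    by (rule antimono_bounded_below_convergent[of a "\<lambda>t. - I t" "- B"]) (use I_mono B in auto)
  from tendsto_minus[OF this] show ?thesis using that by simp
qed

text \<open>The kinetic energy grows at a bounded rate, so a large value at \<open>t\<close> means
  large values on a whole interval before \<open>t\<close>. As the weight in \<open>I\<close> is at
  least \<open>1\<close>, this would give \<open>I\<close> increments that do not tend to
  zero.\<close>

lemma speed_tendsto_0:
  assumes B: "\<And>t. a \<le> t \<Longrightarrow> I t \<le> B"
  shows "((\<lambda>t. (norm (xd t))\<^sup>2 / 2) \<longlongrightarrow> 0) at_top"
proof -
  define g where "g = (\<lambda>t. (norm (xd t))\<^sup>2 / 2)"
  fix i :: 'm
  obtain G where G: "\<And>t. a \<le> t \<Longrightarrow> norm (df i (x t)) \<le> G" using df_bounded by blast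
  obtain V where V: "0 \<le> V" "\<And>t. a \<le> t \<Longrightarrow> norm (xd t) \<le> V" using speed_bounded by blast
  define L where "L = G * V + \<beta> * (M * V)"
  have "0 \<le> G" using G[of a] norm_ge_zero order_trans by blast
  then have L: "0 \<le> L" using V \<beta> M0 by (simp add: L_def)
  have lip: "g t - L * t \<le> g s - L * s" if "a \<le> s" "s \<le> t" for s t
    unfolding g_def
  proof (rule abs_cont_on_diff_antimono[OF kinetic_ac _ _ _ that, where \<psi> = "\<lambda>_. L"])
    show "((*) L has_real_derivative L) (at t)" for t
      using DERIV_cmult_Id[of L] by (simp add: mult.commute)
    show "AE t in lebesgue. a \<le> t \<longrightarrow> (\<exists>D\<le>L. ((\<lambda>t. (norm (xd t))\<^sup>2 / 2) has_real_derivative D) (at t))"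
      using kinetic_deriv dissipation
    proof eventually_elim
      case (elim t)
      show ?case
      proof
        assume t: "a \<le> t"
        have "\<bar>df i (x t) \<bullet> xd t\<bar> \<le> G * V"
          using Cauchy_Schwarz_ineq2[of "df i (x t)" "xd t"] G[OF t] V(2)[OF t] \<open>0 \<le> G\<close>
          by (meson mult_mono norm_ge_zero order_trans)
        moreover have "\<bar>x t \<bullet> xd t\<bar> \<le> M * V"
          using Cauchy_Schwarz_ineq2[of "x t" "xd t"] bounded[OF t] V(2)[OF t] M0
          by (meson mult_mono norm_ge_zero order_trans)
        then have "\<beta> * t powr (-p) * \<bar>x t \<bullet> xd t\<bar> \<le> \<beta> * 1 * (M * V)"
          using \<beta> t a pq q powr_mono[of "-p" 0 t] by (intro mult_mono) auto
        then have "- (\<beta> * t powr (-p) * (x t \<bullet> xd t)) \<le> \<beta> * (M * V)"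
          using \<beta> by (smt (verit) abs_ge_minus_self mult_left_mono mult_minus_right mult_nonneg_nonneg
              powr_ge_zero mult_1_right)
        moreover have "0 \<le> \<alpha> * t powr (-q) * (norm (xd t))\<^sup>2" using \<alpha> by simp
        ultimately have "xd t \<bullet> xdd t \<le> L"
          using elim(2) t unfolding L_def by (smt (verit))
        then show "\<exists>D\<le>L. ((\<lambda>t. (norm (xd t))\<^sup>2 / 2) has_real_derivative D) (at t)"
          using elim(1) t by blast
      qed
    qed
  qed auto
  obtain Iinf where Iinf: "(I \<longlongrightarrow> Iinf) at_top" using I_convergent B by blast
  have upper: "\<forall>\<^sub>F t in at_top. g t < e" if "e > 0" for e
  proof -
    \<comment> \<open>On a window of this length the kinetic energy stays above its final value
      minus \<open>e / 2\<close>; the summand \<open>1\<close> covers \<open>L = 0\<close>.\<close>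
    define \<delta> where "\<delta> = e / (2 * (L + 1))"
    have \<delta>: "\<delta> > 0" using \<open>e > 0\<close> L by (simp add: \<delta>_def)
    have "L * \<delta> < e / 2" using \<open>e > 0\<close> L by (simp add: \<delta>_def field_simps)
    have step: "2 * (g t - L * \<delta>) * \<delta> \<le> I t - I (t - \<delta>)" if t: "a + \<delta> \<le> t" for t
    proof -
      have "I (t - \<delta>) - 2 * (g t - L * \<delta>) * (t - \<delta>) \<le> I t - 2 * (g t - L * \<delta>) * t"
      proof (rule nondecreasing_from_deriv[where s = "t - \<delta>" and t = t and
            G = "\<lambda>r. I r - 2 * (g t - L * \<delta>) * r" and G' = "\<lambda>r. r powr q * (norm (xd r))\<^sup>2 - 2 * (g t - L * \<delta>)"])
        fix r assume r: "t - \<delta> \<le> r" "r \<le> t"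
        have ra: "a \<le> r" using r t by simp
        show "((\<lambda>r. I r - 2 * (g t - L * \<delta>) * r) has_real_derivative
            r powr q * (norm (xd r))\<^sup>2 - 2 * (g t - L * \<delta>)) (at r)"
          by (intro DERIV_diff I_deriv ra DERIV_cmult_Id)
        have "g t - L * \<delta> \<le> g r"
        proof -
          have "L * (t - r) \<le> L * \<delta>" using r L by (intro mult_left_mono) auto
          then show ?thesis using lip[OF ra r(2)] by (simp add: algebra_simps)
        qed
        moreover have "1 * (norm (xd r))\<^sup>2 \<le> r powr q * (norm (xd r))\<^sup>2"
          using ra a q ge_one_powr_ge_zero[of r q] by (intro mult_right_mono) auto
        ultimately show "0 \<le> r powr q * (norm (xd r))\<^sup>2 - 2 * (g t - L * \<delta>)"
          by (simp add: g_def)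
      qed (use \<delta> in auto)
      then show ?thesis by (simp add: algebra_simps)
    qed
    have "filterlim (\<lambda>t. - \<delta> + t) at_top at_top"
      by (rule filterlim_tendsto_add_at_top[OF tendsto_const filterlim_ident])
    then have "((\<lambda>t. I (- \<delta> + t)) \<longlongrightarrow> Iinf) at_top"
      by (rule filterlim_compose[OF Iinf])
    from tendsto_diff[OF Iinf this] have "((\<lambda>t. I t - I (- \<delta> + t)) \<longlongrightarrow> 0) at_top" by simp
    then have "\<forall>\<^sub>F t in at_top. I t - I (- \<delta> + t) < e * \<delta>"
      by (rule order_tendstoD) (use \<open>e > 0\<close> \<delta> in simp)
    then show ?thesis using eventually_ge_at_top[of "a + \<delta>"]
    proof eventually_elim
      case (elim t)
      then have "2 * (g t - L * \<delta>) * \<delta> < e * \<delta>" using step[of t] by simp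
      then have "2 * (g t - L * \<delta>) < e" using \<delta> by simp
      then show ?case using \<open>L * \<delta> < e / 2\<close> by simp
    qed
  qed
  show ?thesis
    unfolding g_def[symmetric]
  proof (rule order_tendstoI)
    fix e :: real assume "e < 0"
    moreover have "0 \<le> g t" for t by (simp add: g_def)
    ultimately have "e < g t" for t by (rule less_le_trans)
    then show "\<forall>\<^sub>F t in at_top. e < g t" by simp
  qed (rule upper)
qed

section \<open>Distances to anchor points\<close>

text \<open>With weight \<open>t powr q / \<alpha>\<close> the friction term becomes exactly
  \<open>- h'\<close> and cancels the derivative of \<open>h\<close>. The gap \<open>\<eta>\<close>
  integrates to the growing power, and every error is bounded by the derivative of
  \<open>C * (I t + t powr (1 + q - p) / (1 + q - p))\<close>.\<close>

lemma lyapunov_antimono: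
  assumes W: "\<And>i t. a \<le> t \<Longrightarrow> Winf i + Dinf \<le> W i t + D t"
    and Dinf: "\<And>t. a \<le> t \<Longrightarrow> D t \<le> Dinf" and z: "\<And>i. f i z + \<eta> \<le> Winf i"
  obtains C where "0 \<le> C" and "\<And>s t. a \<le> s \<Longrightarrow> s \<le> t \<Longrightarrow>
    (norm (x t - z))\<^sup>2 / 2 + t powr q / \<alpha> * ((x t - z) \<bullet> xd t) + \<eta> / \<alpha> * (t powr (1 + q) / (1 + q))
      - C * (I t + t powr (1 + q - p) / (1 + q - p))
    \<le> (norm (x s - z))\<^sup>2 / 2 + s powr q / \<alpha> * ((x s - z) \<bullet> xd s) + \<eta> / \<alpha> * (s powr (1 + q) / (1 + q))
      - C * (I s + s powr (1 + q - p) / (1 + q - p))"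
proof -
  define N where "N = M + norm z"
  have N: "N \<ge> 0" using M0 by (simp add: N_def)
  define h1 where "h1 = (\<lambda>t. (x t - z) \<bullet> xd t)"
  have h1: "\<bar>h1 t\<bar> \<le> N * norm (xd t)" if "a \<le> t" for t
    using dist_times_speed[OF that, of z] by (simp add: h1_def N_def)
  define k where "k = q / \<alpha> * N"
  have k: "0 \<le> k" using q \<alpha> N by (simp add: k_def)
  \<comment> \<open>The summands are the error coefficients: \<open>1 / 4\<close> and
    \<open>k\<^sup>2\<close> from Young's inequality with constant \<open>1\<close>, the others from
    the kinetic and \<open>\<beta>\<close> terms. Adding them lets one constant serve both error
    functions.\<close>
  define C where "C = 1 / 4 + k\<^sup>2 + 3 / (2 * \<alpha>) + \<beta> * (norm z)\<^sup>2 / (2 * \<alpha>)"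
  have C: "0 \<le> C" using \<alpha> \<beta> by (simp add: C_def)
  define \<Psi> where "\<Psi> = (\<lambda>t. - ((norm (x t - z))\<^sup>2 / 2) - \<eta> / \<alpha> * (t powr (1 + q) / (1 + q))
      + C * (I t + t powr (1 + q - p) / (1 + q - p)))"
  define \<psi> where "\<psi> = (\<lambda>t. - ((x t - z) \<bullet> xd t) - \<eta> / \<alpha> * t powr q
      + C * (t powr q * (norm (xd t))\<^sup>2 + t powr (q - p)))"
  have "t powr q / \<alpha> * ((x t - z) \<bullet> xd t) - \<Psi> t \<le> s powr q / \<alpha> * ((x s - z) \<bullet> xd s) - \<Psi> s"
    if st: "a \<le> s" "s \<le> t" for s t
  proof (rule weighted_anchor_antimono[where Dinf = Dinf and \<eta> = \<eta> and Winf = Winf and b = a and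
        w' = "\<lambda>t. q * t powr (q - 1) / \<alpha>" and \<psi> = \<psi>])
    fix t assume t: "a \<le> t"
    then have t1: "1 \<le> t" "0 < t" using a by auto
    show "((\<lambda>t. t powr q / \<alpha>) has_real_derivative q * t powr (q - 1) / \<alpha>) (at t)"
      by (intro DERIV_cdivide has_real_derivative_powr t1)
    show "0 \<le> t powr q / \<alpha>" using \<alpha> by simp
    have 1: "((\<lambda>t. t powr (1 + q) / (1 + q)) has_real_derivative t powr q) (at t)"
      using DERIV_cdivide[OF has_real_derivative_powr[OF t1(2), of "1 + q"], of "1 + q"] q by simp
    show "(\<Psi> has_real_derivative \<psi> t) (at t)"
      unfolding \<Psi>_def \<psi>_def
      by (intro DERIV_add DERIV_diff DERIV_minus DERIV_cmult dist_deriv powr_antideriv I_deriv t 1)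
    define u where "u = norm (xd t)"
    define P where "P = t powr q"
    define E where "E = t powr (q - p)"
    have "P \<ge> 0" "E \<ge> 0" by (simp_all add: P_def E_def)
    have "q / \<alpha> * t powr (q - 1) * h1 t \<le> q / \<alpha> * t powr (q - 1) * (N * u)"
      using h1[OF t] q \<alpha> by (intro mult_left_mono) (auto simp: u_def)
    also have "\<dots> = k * t powr (q - 1) * u" by (simp add: k_def)
    also have "\<dots> \<le> 1 / 4 * P * u\<^sup>2 + k\<^sup>2 / 1 * E"
      unfolding P_def E_def by (rule young_powr) (use t1 p in auto)
    finally have A: "q / \<alpha> * t powr (q - 1) * h1 t \<le> 1 / 4 * (P * u\<^sup>2) + k\<^sup>2 * E" by simp
    have e: "P * t powr (-q) = 1" "P * t powr (-p) = E"
      using t1 unfolding P_def E_def by (simp_all flip: powr_add)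
    have "q * t powr (q - 1) / \<alpha> * h1 t + P / \<alpha> *
      (- \<alpha> * t powr (-q) * h1 t - (Dinf - D t) - \<eta> + 3 / 2 * u\<^sup>2 + \<beta> / 2 * t powr (-p) * (norm z)\<^sup>2)
      = q / \<alpha> * t powr (q - 1) * h1 t - (P * t powr (-q)) * h1 t - P / \<alpha> * (Dinf - D t) - \<eta> / \<alpha> * P
        + 3 / (2 * \<alpha>) * (P * u\<^sup>2) + \<beta> * (norm z)\<^sup>2 / (2 * \<alpha>) * (P * t powr (-p))"
      using \<alpha> by (simp add: field_simps)
    also have "\<dots> \<le> - h1 t - \<eta> / \<alpha> * P + C * (P * u\<^sup>2 + E)"
    proof -
      have "0 \<le> P / \<alpha> * (Dinf - D t)" using \<open>P \<ge> 0\<close> \<alpha> Dinf[OF t] by simp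
      moreover have "C * (P * u\<^sup>2 + E) - (1 / 4 * (P * u\<^sup>2) + k\<^sup>2 * E + 3 / (2 * \<alpha>) * (P * u\<^sup>2)
          + \<beta> * (norm z)\<^sup>2 / (2 * \<alpha>) * E) = (k\<^sup>2 + \<beta> * (norm z)\<^sup>2 / (2 * \<alpha>)) * (P * u\<^sup>2)
            + (1 / 4 + 3 / (2 * \<alpha>)) * E"
        unfolding C_def by (simp add: algebra_simps add_divide_distrib)
      moreover have "0 \<le> (k\<^sup>2 + \<beta> * (norm z)\<^sup>2 / (2 * \<alpha>)) * (P * u\<^sup>2) + (1 / 4 + 3 / (2 * \<alpha>)) * E"
        using \<open>P \<ge> 0\<close> \<open>E \<ge> 0\<close> \<alpha> \<beta> by (intro add_nonneg_nonneg mult_nonneg_nonneg) auto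
      ultimately show ?thesis using A unfolding e by linarith
    qed
    finally show "q * t powr (q - 1) / \<alpha> * ((x t - z) \<bullet> xd t) + t powr q / \<alpha> *
      (- \<alpha> * t powr (-q) * ((x t - z) \<bullet> xd t) - (Dinf - D t) - \<eta> + 3 / 2 * (norm (xd t))\<^sup>2
        + \<beta> / 2 * t powr (-p) * (norm z)\<^sup>2) \<le> \<psi> t"
      unfolding h1_def u_def P_def E_def \<psi>_def .
  next
    show "continuous_on {a..} \<psi>"
      unfolding \<psi>_def by (intro continuous_intros powr_cont xd_cont x_cont)
    show "continuous_on {a..} (\<lambda>t. q * t powr (q - 1) / \<alpha>)"
      using \<alpha> by (intro continuous_intros powr_cont) auto
  qed (use W z st in auto)
  then show ?thesis using that[OF C] by (simp add: \<Psi>_def algebra_simps)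
qed

lemma filter_not_below:
  assumes "a \<le> b" and "\<And>t. b \<le> t \<Longrightarrow>
    (norm (x t - z))\<^sup>2 / 2 + t powr q / \<alpha> * ((x t - z) \<bullet> xd t) \<le> -1"
  shows False
  by (rule first_order_filter_not_below[OF \<alpha> q1, of b "\<lambda>t. (norm (x t - z))\<^sup>2 / 2" "\<lambda>t. (x t - z) \<bullet> xd t"])
    (use assms a dist_deriv in auto)

text \<open>The case \<open>\<eta> = 0\<close>: the corrected \<open>\<Phi>\<close> is
  nonincreasing, and the error terms converge. Falling below \<open>-1 - C * B\<close> would keep
  \<open>\<Phi>\<close> itself below \<open>-1\<close> forever, which
  \<open>filter_not_below\<close> excludes; so \<open>\<Phi>\<close> converges, and the squared
  distance with it.\<close>

lemma dist_convergent:
  assumes W: "\<And>i t. a \<le> t \<Longrightarrow> Winf i + Dinf \<le> W i t + D t"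
    and Dinf: "\<And>t. a \<le> t \<Longrightarrow> D t \<le> Dinf" and z: "\<And>i. f i z \<le> Winf i"
  obtains l where "((\<lambda>t. (norm (x t - z))\<^sup>2 / 2) \<longlongrightarrow> l) at_top"
proof -
  define \<Phi> where "\<Phi> = (\<lambda>t. (norm (x t - z))\<^sup>2 / 2 + t powr q / \<alpha> * ((x t - z) \<bullet> xd t))"
  define r where "r = (\<lambda>t. t powr (1 + q - p) / (1 + q - p))"
  have r_neg: "r t \<le> 0" for t using pq by (simp add: r_def divide_nonneg_neg)
  have r_lim: "(r \<longlongrightarrow> 0 / (1 + q - p)) at_top"
    unfolding r_def using pq by (intro tendsto_divide tendsto_const tendsto_neg_powr filterlim_ident) auto
  obtain B where B: "\<And>t. a \<le> t \<Longrightarrow> I t \<le> B" using I_bounded[of Winf Dinf z] W Dinf z by blast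
  obtain Iinf where Iinf: "(I \<longlongrightarrow> Iinf) at_top" using I_convergent B by blast
  obtain C where C: "0 \<le> C" and anti: "\<And>s t. a \<le> s \<Longrightarrow> s \<le> t \<Longrightarrow>
      \<Phi> t - C * (I t + r t) \<le> \<Phi> s - C * (I s + r s)"
    by (rule lyapunov_antimono[of Winf Dinf z 0])
      (use W Dinf z in \<open>auto simp: \<Phi>_def r_def\<close>)
  have low: "-1 - C * B \<le> \<Phi> s - C * (I s + r s)" if s: "a \<le> s" for s
  proof (rule ccontr)
    assume neg: "\<not> ?thesis"
    have "\<Phi> t \<le> -1" if t: "s \<le> t" for t
    proof -
      have "C * (I t + r t) \<le> C * B" using C B[of t] r_neg[of t] s t by (intro mult_left_mono) auto
      then show ?thesis using anti[OF s t] neg by simp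
    qed
    then show False by (intro filter_not_below[OF s, of z]) (simp add: \<Phi>_def)
  qed
  obtain l where "((\<lambda>t. \<Phi> t - C * (I t + r t)) \<longlongrightarrow> l) at_top"
    by (rule antimono_bounded_below_convergent[of a "\<lambda>t. \<Phi> t - C * (I t + r t)" "-1 - C * B"])
      (use anti low in auto)
  from tendsto_add[OF this tendsto_mult[OF tendsto_const tendsto_add[OF Iinf r_lim]], of C]
  obtain l' where l': "(\<Phi> \<longlongrightarrow> l') at_top" by auto
  have "((\<lambda>t. (norm (x t - z))\<^sup>2 / 2) \<longlongrightarrow> l') at_top"
    using tendsto_from_first_order_filter[OF \<alpha> q1 dist_deriv l'[unfolded \<Phi>_def]] .
  then show ?thesis by (rule that)
qed

text \<open>Finitely many strict inequalities leave a uniform gap \<open>\<eta> > 0\<close>. The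
  power \<open>t powr (1 + q)\<close> that it contributes then drives
  \<open>h + t powr q / \<alpha> * h'\<close> below \<open>-1\<close> for all large times, although
  \<open>h\<close> is nonnegative.\<close>

lemma no_strict_improvement:
  assumes W: "\<And>i t. a \<le> t \<Longrightarrow> Winf i + Dinf \<le> W i t + D t"
    and Dinf: "\<And>t. a \<le> t \<Longrightarrow> D t \<le> Dinf" and z: "\<And>i. f i z < Winf i"
  shows False
proof -
  define \<eta> where "\<eta> = Min (range (\<lambda>i. Winf i - f i z))"
  have \<eta>: "\<eta> > 0" using z by (simp add: \<eta>_def)
  have "\<eta> \<le> Winf i - f i z" for i unfolding \<eta>_def by (intro Min_le) auto
  then have z': "f i z + \<eta> \<le> Winf i" for i by (simp add: algebra_simps)
  obtain B where B: "\<And>t. a \<le> t \<Longrightarrow> I t \<le> B"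
    using I_bounded[of Winf Dinf z] W Dinf z less_imp_le by metis
  define r where "r = (\<lambda>t. t powr (1 + q - p) / (1 + q - p))"
  have r_neg: "r t \<le> 0" for t using pq by (simp add: r_def divide_nonneg_neg)
  obtain C where C: "0 \<le> C" and anti: "\<And>s t. a \<le> s \<Longrightarrow> s \<le> t \<Longrightarrow>
      (norm (x t - z))\<^sup>2 / 2 + t powr q / \<alpha> * ((x t - z) \<bullet> xd t) + \<eta> / \<alpha> * (t powr (1 + q) / (1 + q))
        - C * (I t + r t)
      \<le> (norm (x s - z))\<^sup>2 / 2 + s powr q / \<alpha> * ((x s - z) \<bullet> xd s) + \<eta> / \<alpha> * (s powr (1 + q) / (1 + q))
        - C * (I s + r s)"
    by (rule lyapunov_antimono[of Winf Dinf z \<eta>]) (use W Dinf z' in \<open>auto simp: r_def\<close>)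
  define c where "c = (norm (x a - z))\<^sup>2 / 2 + a powr q / \<alpha> * ((x a - z) \<bullet> xd a)
      + \<eta> / \<alpha> * (a powr (1 + q) / (1 + q)) - C * (I a + r a)"
  have "LIM t at_top. \<eta> / \<alpha> / (1 + q) * t powr (1 + q) :> at_top"
    using \<eta> \<alpha> q by (intro filterlim_tendsto_pos_mult_at_top[OF tendsto_const] powr_tendsto_at_top) auto
  then have "\<forall>\<^sub>F t in at_top. c + C * B + 1 \<le> \<eta> / \<alpha> / (1 + q) * t powr (1 + q)"
    by (simp add: filterlim_at_top)
  then obtain b0 where b0: "\<And>t. b0 \<le> t \<Longrightarrow> c + C * B + 1 \<le> \<eta> / \<alpha> / (1 + q) * t powr (1 + q)"
    unfolding eventually_at_top_linorder by blast
  show False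
  proof (rule filter_not_below[of "max a b0" z])
    fix t assume "max a b0 \<le> t"
    then have t: "a \<le> t" "b0 \<le> t" by auto
    have "C * (I t + r t) \<le> C * B" using C B[OF t(1)] r_neg[of t] by (intro mult_left_mono) auto
    moreover have "c + C * B + 1 \<le> \<eta> / \<alpha> * (t powr (1 + q) / (1 + q))" using b0[OF t(2)] by simp
    ultimately show "(norm (x t - z))\<^sup>2 / 2 + t powr q / \<alpha> * ((x t - z) \<bullet> xd t) \<le> -1"
      using anti[OF order_refl t(1)] unfolding c_def[symmetric] by linarith
  qed simp
qed

theorem weak_convergence:
  "\<exists>finf. (\<forall>i. ((\<lambda>t. f i (x t)) \<longlongrightarrow> finf i) at_top) \<and>
    (\<exists>xs. (\<forall>y. ((\<lambda>t. x t \<bullet> y) \<longlongrightarrow> xs \<bullet> y) at_top) \<and> xs \<in> wpareto f \<and> (\<forall>i. f i xs \<le> finf i))"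
proof -
  obtain Winf Dinf where Winf: "\<And>i. (W i \<longlongrightarrow> Winf i) at_top"
    and Dinf: "\<And>t. a \<le> t \<Longrightarrow> D t \<le> Dinf" and W: "\<And>i t. a \<le> t \<Longrightarrow> Winf i + Dinf \<le> W i t + D t"
    by (rule energy_limits, rule that)
  have bdd: "\<forall>\<^sub>F t in at_top. norm (x t) \<le> M"
    using eventually_ge_at_top[of a] by eventually_elim (rule bounded)
  \<comment> \<open>A weak cluster point provides the anchor with \<open>f i z \<le> Winf i\<close>
    that the bound on \<open>I\<close> requires.\<close>
  obtain G z where G: "G \<noteq> bot" "G \<le> at_top" "\<And>u. ((\<lambda>t. x t \<bullet> u) \<longlongrightarrow> z \<bullet> u) G"
    using bounded_weak_cluster[OF trivial_limit_at_top_linorder bdd] by metis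
  have "f i z \<le> Winf i" for i using weak_cluster_le[of i Winf, OF Winf G] .
  then obtain B where B: "\<And>t. a \<le> t \<Longrightarrow> I t \<le> B"
    using I_bounded[of Winf Dinf z] W Dinf by blast
  \<comment> \<open>With the speed vanishing too, \<open>f i (x t)\<close> inherits the limit of
    \<open>W i\<close>.\<close>
  have "((\<lambda>t. \<beta> / 2 * t powr (-p) * (norm (x t))\<^sup>2) \<longlongrightarrow> 0) at_top"
  proof (rule Lim_null_comparison)
    show "((\<lambda>t. \<beta> / 2 * t powr (-p) * M\<^sup>2) \<longlongrightarrow> 0) at_top"
      using pq q by (intro tendsto_mult_left_zero tendsto_mult_right_zero tendsto_neg_powr filterlim_ident) auto
    show "\<forall>\<^sub>F t in at_top. norm (\<beta> / 2 * t powr (-p) * (norm (x t))\<^sup>2) \<le> \<beta> / 2 * t powr (-p) * M\<^sup>2"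
      using bdd by eventually_elim
        (use \<beta> in \<open>auto simp: abs_mult intro!: mult_left_mono power_mono\<close>)
  qed
  from tendsto_diff[OF tendsto_diff[OF Winf speed_tendsto_0[OF B]] this]
  have lim: "((\<lambda>t. f i (x t)) \<longlongrightarrow> Winf i) at_top" for i by (simp add: W_def)
  have "\<exists>xs\<in>{z. \<forall>i. f i z \<le> Winf i}. \<forall>u. ((\<lambda>t. x t \<bullet> u) \<longlongrightarrow> xs \<bullet> u) at_top"
  proof (rule opial[OF bdd])
    fix z assume "z \<in> {z. \<forall>i. f i z \<le> Winf i}"
    then obtain l where "((\<lambda>t. (norm (x t - z))\<^sup>2 / 2) \<longlongrightarrow> l) at_top"
      using dist_convergent[of Winf Dinf z] W Dinf by blast
    from tendsto_mult[OF this tendsto_const, of 2]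
    show "\<exists>l. ((\<lambda>t. (norm (x t - z))\<^sup>2) \<longlongrightarrow> l) at_top" by auto
  next
    fix G z assume "G \<noteq> bot" "G \<le> at_top" "\<And>u. ((\<lambda>t. x t \<bullet> u) \<longlongrightarrow> z \<bullet> u) G"
    then show "z \<in> {z. \<forall>i. f i z \<le> Winf i}" using weak_cluster_le[of _ Winf G z] Winf by blast
  qed
  then obtain xs where xs: "\<And>i. f i xs \<le> Winf i" "\<And>u. ((\<lambda>t. x t \<bullet> u) \<longlongrightarrow> xs \<bullet> u) at_top" by blast
  have "xs \<in> wpareto f"
  proof (rule ccontr)
    assume "xs \<notin> wpareto f"
    then obtain y where "\<And>i. f i y < f i xs" by (auto simp: wpareto_def)
    \<comment> \<open>Strict improvement on \<open>xs\<close> is strict improvement on the limit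
      values, as \<open>f i xs \<le> Winf i\<close>.\<close>
    then have "f i y < Winf i" for i using xs(1) by (rule less_le_trans)
    then show False using no_strict_improvement[of Winf Dinf y] W Dinf by blast
  qed
  then show ?thesis using lim xs by blast
qed

end

section \<open>The projection equation\<close>

text \<open>Restriction to the line through \<open>y\<close> and \<open>z\<close> reduces this to
  the tangent inequality for a convex function of one real variable.\<close>

lemma convex_gradient_inequality:
  fixes f :: "'a::real_inner \<Rightarrow> real"
  assumes convex: "convex_on UNIV f" and deriv: "(f has_derivative (\<lambda>h. g \<bullet> h)) (at y)"
  shows "f y + g \<bullet> (z - y) \<le> f z"
proof -
  define \<phi> where "\<phi> = (\<lambda>s::real. f (y + s *\<^sub>R (z - y)))"
  have "convex_on UNIV \<phi>"
  proof (rule convex_onI)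
    fix t u v :: real assume t: "0 < t" "t < 1"
    have "y + ((1 - t) * u + t * v) *\<^sub>R (z - y)
        = (1 - t) *\<^sub>R (y + u *\<^sub>R (z - y)) + t *\<^sub>R (y + v *\<^sub>R (z - y))"
      by (simp add: algebra_simps)
    then show "\<phi> ((1 - t) *\<^sub>R u + t *\<^sub>R v) \<le> (1 - t) * \<phi> u + t * \<phi> v"
      unfolding \<phi>_def using convex_onD[OF convex, of t] t by simp
  qed simp
  moreover have "(\<phi> has_field_derivative g \<bullet> (z - y)) (at 0 within UNIV)"
  proof -
    have "((\<lambda>s::real. y + s *\<^sub>R (z - y)) has_derivative (\<lambda>h. h *\<^sub>R (z - y))) (at 0)"
      by (auto intro!: derivative_eq_intros)
    then have "(\<phi> has_derivative (\<lambda>h. g \<bullet> (h *\<^sub>R (z - y)))) (at 0)"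
      unfolding \<phi>_def by (rule has_derivative_compose) (use deriv in simp)
    then show ?thesis unfolding has_field_derivative_def
      by (rule has_derivative_eq_rhs) auto
  qed
  ultimately have "g \<bullet> (z - y) * (1 - 0) \<le> \<phi> 1 - \<phi> 0"
    by (intro convex_on_imp_above_tangent[of UNIV]) auto
  then show ?thesis by (simp add: \<phi>_def)
qed

text \<open>The equation says that the projection of \<open>0\<close> onto the shifted hull is
  \<open>- e *\<^sub>R v\<close>. Its membership in that set gives the first claim; its variational
  inequality, tested at the shifted vertex \<open>g i\<close>, gives the second.\<close>

lemma steering_equation_cases:
  fixes g :: "'m::finite \<Rightarrow> 'a::real_inner" and u v w :: 'a
  assumes e: "e > 0" and eq: "e *\<^sub>R v + proj ((\<lambda>c. c + u + w) ` (convex hull (range g))) 0 = 0"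
  shows "\<exists>c\<in>convex hull (range g). w = - e *\<^sub>R v - u - c"
    and "v \<bullet> (g i + u + w + e *\<^sub>R v) \<le> 0"
proof -
  define K where "K = (\<lambda>c. c + u + w) ` (convex hull (range g))"
  have K: "K = (+) (u + w) ` (convex hull (range g))"
    unfolding K_def by (auto simp: image_iff algebra_simps)
  have K_props: "compact K" "convex K" "K \<noteq> {}"
    unfolding K using compact_translation[OF finite_imp_compact_convex_hull[of "range g"]]
    by (auto intro: convex_translation)
  have in_K: "proj K 0 \<in> K" by (rule proj_properties(1)[OF K_props])
  have var: "(0 - proj K 0) \<bullet> (y - proj K 0) \<le> 0" if "y \<in> K" for y
    by (rule proj_properties(2)[OF K_props that])
  have P: "proj K 0 = - (e *\<^sub>R v)" using eq by (simp add: K_def eq_neg_iff_add_eq_0 add.commute)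
  obtain c where "c \<in> convex hull (range g)" "- (e *\<^sub>R v) = c + u + w"
    using in_K P by (auto simp: K_def)
  then show "\<exists>c\<in>convex hull (range g). w = - e *\<^sub>R v - u - c"
    by (intro bexI[of _ c]) (simp_all add: algebra_simps)
  have "g i + u + w \<in> K" by (auto simp: K_def intro: hull_inc)
  then have "e * (v \<bullet> (g i + u + w + e *\<^sub>R v)) \<le> 0" using var P by force
  then show "v \<bullet> (g i + u + w + e *\<^sub>R v) \<le> 0" using e by (simp add: mult_le_0_iff)
qed

theorem mainTheorem18:
  fixes f :: "'m::finite \<Rightarrow> 'a::{real_inner,complete_space} \<Rightarrow> real"
    and df :: "'m \<Rightarrow> 'a \<Rightarrow> 'a"
    and t0 \<alpha> \<beta> q p :: real and x0 v0 :: 'a and x :: "real \<Rightarrow> 'a"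
  assumes convex: "\<And>i. convex_on UNIV (f i)"
    and grad: "\<And>i y. (f i has_derivative (\<lambda>h. df i y \<bullet> h)) (at y)"
    and lip: "\<And>i. \<exists>L. \<forall>y z. norm (df i y - df i z) \<le> L * norm (y - z)"
    and t0: "t0 > 0" and \<alpha>: "\<alpha> > 0" and \<beta>: "\<beta> > 0"
    and q: "0 < q" "q \<le> 1" and p: "0 < p" "p \<le> 2"
    and params: "(p < 2 \<and> q + 1 < p) \<or> (p = 2 \<and> q < 1 \<and> \<beta> \<ge> q * (1 - q))"
    and A3: "A3 f t0 \<beta> p x0 v0"
    and A4: "A4 f"
    and sol: "mtrigs_solution df t0 \<alpha> \<beta> q p x0 v0 x"
    and bdd: "bounded (x ` {t0..})"
  shows "\<exists>finf :: 'm \<Rightarrow> real.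
           (\<forall>i. ((\<lambda>t. f i (x t)) \<longlongrightarrow> finf i) at_top) \<and>
           (\<exists>xs. (\<forall>y. ((\<lambda>t. x t \<bullet> y) \<longlongrightarrow> xs \<bullet> y) at_top) \<and>
                 xs \<in> wpareto f \<and> (\<forall>i. f i xs \<le> finf i))"
proof -
  obtain xd xdd where x_deriv: "\<And>t. t0 \<le> t \<Longrightarrow> (x has_vector_derivative xd t) (at t within {t0..})"
    and xd_cont: "continuous_on {t0..} xd"
    and xd_ac: "\<And>T. t0 \<le> T \<Longrightarrow> abs_cont_on {t0..T} xd"
    and xd_deriv: "AE t in lebesgue. t0 \<le> t \<longrightarrow> (xd has_vector_derivative xdd t) (at t)"
    and eq: "AE t in lebesgue. t0 \<le> t \<longrightarrow>
         (\<alpha> / t powr q) *\<^sub>R xd t +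
         proj ((\<lambda>c. c + (\<beta> / t powr p) *\<^sub>R x t + xdd t) ` (convex hull (range (\<lambda>i. df i (x t))))) 0 = 0"
    using sol unfolding mtrigs_solution_def by blast
  obtain M where M: "\<And>t. t0 \<le> t \<Longrightarrow> norm (x t) \<le> M"
    using bdd unfolding bounded_iff by fastforce
  \<comment> \<open>Starting strictly after \<open>t0\<close> makes the derivative of
    \<open>x\<close> two-sided; starting at \<open>1\<close> or later allows comparison of powers of
    \<open>t\<close>.\<close>
  define a where "a = max (t0 + 1) 1"
  have a: "t0 < a" "1 \<le> a" by (auto simp: a_def)
  interpret mtrigs_tail f df \<alpha> \<beta> q p a M x xd xdd
  proof
    show "f i y + df i y \<bullet> (z - y) \<le> f i z" for i y z
      using convex grad by (rule convex_gradient_inequality)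
    show "(x has_vector_derivative xd t) (at t)" if "a \<le> t" for t
    proof -
      have "at t within {t0..} = at t" using that a by (intro at_within_interior) simp
      then show ?thesis using x_deriv[of t] that a by simp
    qed
    show "continuous_on {a..} xd" by (rule continuous_on_subset[OF xd_cont]) (use a in auto)
    show "abs_cont_on {a..T} xd" for T
      by (rule abs_cont_on_subset[OF xd_ac[of "max t0 T"]]) (use a in auto)
    show "AE t in lebesgue. a \<le> t \<longrightarrow> (xd has_vector_derivative xdd t) (at t)"
      using xd_deriv by eventually_elim (use a in auto)
    show "AE t in lebesgue. a \<le> t \<longrightarrow> (\<forall>i. xd t \<bullet> xdd t \<le>
        - (df i (x t) \<bullet> xd t) - \<beta> * t powr (-p) * (x t \<bullet> xd t) - \<alpha> * t powr (-q) * (norm (xd t))\<^sup>2)"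
      using eq
    proof eventually_elim
      case (elim t)
      show ?case
      proof (intro impI allI)
        fix i assume t: "a \<le> t"
        have pos: "0 < \<alpha> / t powr q" using t a \<alpha> by simp
        have "xd t \<bullet> (df i (x t) + (\<beta> / t powr p) *\<^sub>R x t + xdd t + (\<alpha> / t powr q) *\<^sub>R xd t) \<le> 0"
          by (rule steering_equation_cases(2)[OF pos]) (use elim t a in auto)
        then show "xd t \<bullet> xdd t \<le> - (df i (x t) \<bullet> xd t) - \<beta> * t powr (-p) * (x t \<bullet> xd t)
            - \<alpha> * t powr (-q) * (norm (xd t))\<^sup>2"
          by (simp add: inner_add_right inner_commute power2_norm_eq_inner powr_minus_divide)
      qed
    qed
    show "AE t in lebesgue. a \<le> t \<longrightarrow> (\<exists>c\<in>convex hull (range (\<lambda>i. df i (x t))).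
        xdd t = - (\<alpha> * t powr (-q)) *\<^sub>R xd t - (\<beta> * t powr (-p)) *\<^sub>R x t - c)"
      using eq
    proof eventually_elim
      case (elim t)
      show ?case
      proof
        assume t: "a \<le> t"
        have pos: "0 < \<alpha> / t powr q" using t a \<alpha> by simp
        have "\<exists>c\<in>convex hull (range (\<lambda>i. df i (x t))).
            xdd t = - (\<alpha> / t powr q) *\<^sub>R xd t - (\<beta> / t powr p) *\<^sub>R x t - c"
          by (rule steering_equation_cases(1)[OF pos]) (use elim t a in auto)
        then show "\<exists>c\<in>convex hull (range (\<lambda>i. df i (x t))).
            xdd t = - (\<alpha> * t powr (-q)) *\<^sub>R xd t - (\<beta> * t powr (-p)) *\<^sub>R x t - c"
          by (simp add: powr_minus_divide)
      qed
    qed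
  \<comment> \<open>Both parameter alternatives give \<open>q + 1 < p\<close>: in the second one,
    \<open>p = 2\<close> and \<open>q < 1\<close>.\<close>
  qed (use grad lip \<alpha> \<beta> q p params a M in auto)
  show ?thesis by (rule weak_convergence)
qed

end
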